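(* Let $k\ge 2$. Identify $\mathbb{R}^{E(\mathcal{O}_k)}$ with $\mathbb{R}^{\mathcal{S}_k}$ via edge labels. Then $P_k=P(\mathcal{O}_k)$. Consequently, the set of vertices of $P_k$ is $\{\vec{e}_{\mathcal{C}}\mid\mathcal{C}\text{ is a simple cycle of }\mathcal{O}_k\}$, the dimension of $P_k$ is $k!-(k-1)!$, and $$P_k=\Big\{\vec v\in[0,1]^{\mathcal{S}_k}\ \Big|\ \sum_{\pi\in\mathcal{S}_k}v_\pi=1,\ \ \sum_{\pi:\,\mathrm{be}(\pi)=\rho}v_\pi=\sum_{\pi:\,\mathrm{en}(\pi)=\rho}v_\pi\ \text{ for all }\rho\in\mathcal{S}_{k-1}\Big\}.$$
   Context: $\mathcal{S}_n$ is the set of permutations of $[n]$, $\mathcal{S}$ the set of all finite permutations. For distinct reals, $\mathrm{std}(x_1,\dots,x_n)$ is the unique $\pi\in\mathcal{S}_n$ with $\pi(i)<\pi(j)\iff x_i<x_j$; for $\sigma\in\mathcal{S}_n$, $I\subseteq[n]$, $\mathrm{pat}_I(\sigma)=\mathrm{std}((\sigma(i))_{i\in I})$. $\mathrm{c\text{-}occ}(\pi,\sigma)$ is the number of intervals $I\subseteq[n]$ with $\mathrm{pat}_I(\sigma)=\pi$, and $\widetilde{\mathrm{c\text{-}occ}}(\pi,\sigma)=\mathrm{c\text{-}occ}(\pi,\sigma)/n$ for $\sigma\in\mathcal{S}_n$. The feasible region is $P_k=\{\vec v\in[0,1]^{\mathcal{S}_k}\mid\exists(\sigma^m)\in\mathcal{S}^{\mathbb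 N}: |\sigma^m|\to\infty,\ \widetilde{\mathrm{c\text{-}occ}}(\pi,\sigma^m)\to v_\pi\ \forall\pi\in\mathcal{S}_k\}$. For $\pi\in\mathcal{S}_k$, $\mathrm{be}(\pi)=\mathrm{pat}_{[1,k-1]}(\pi)$, $\mathrm{en}(\pi)=\mathrm{pat}_{[2,k]}(\pi)$. The overlap graph $\mathcal{O}_k$ is the directed multigraph with vertex set $\mathcal{S}_{k-1}$ and, for each $\pi\in\mathcal{S}_k$, one edge labeled $\pi$ from $\mathrm{be}(\pi)$ to $\mathrm{en}(\pi)$. For a directed multigraph $G$: a walk is a sequence of edges $(e_1,\dots,e_s)$ with $\mathrm{ar}(e_i)=\mathrm{st}(e_{i+1})$; a cycle is a walk with $\mathrm{st}(e_1)=\mathrm{ar}(e_s)$; a path is a walk with distinct edges and distinct vertices except possibly $\mathrm{st}(e_1)=\mathrm{ar}(e_s)$; a simple cycle is a non-empty cycle that is a path. For a non-empty cycle $\mathcal{C}$, $(\vec{e}_{\mathcal{C}})_e=n_e(\mathcal{C})/|\mathcal{C}|$ ($n_e$ = number of traversals of $e$, $|\mathcal{C}|$ = number of edges), and the cycle polytope is $P(G)=\mathrm{conv}\{\vec{e}_{\mathcal{C}}\mid\mathcal{C}\text{ simple cycle of }G\}$. The dimension of a polytope is that of its affine span. *)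

theory Defs
  imports "HOL-Analysis.Analysis"
begin

text \<open>Permutations of size n, written in one-line notation as lists with values 0..n-1
  (a shift of the paper's [n] = 1..n).\<close>
definition perms :: "nat \<Rightarrow> nat list set" where
  "perms n = {p. distinct p \<and> set p = {..<n}}"

definition std :: "'a::linorder list \<Rightarrow> nat list" where
  "std xs = map (\<lambda>x. card {y \<in> set xs. y < x}) xs"

definition cocc :: "nat list \<Rightarrow> nat list \<Rightarrow> nat" where
  "cocc p s = card {i. i + length p \<le> length s \<and>
                            std (take (length p) (drop i s)) = p}"

definition cocc_prop :: "nat list \<Rightarrow> nat list \<Rightarrow> real" where
  "cocc_prop p s = real (cocc p s) / real (length s)"

text \<open>Vectors in R^(S_k) are functions on nat lists vanishing outside perms k.\<close>
definition supp_in :: "nat \<Rightarrow> (nat list \<Rightarrow> real) \<Rightarrow> bool" where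
  "supp_in k v \<longleftrightarrow> (\<forall>p. p \<notin> perms k \<longrightarrow> v p = 0)"

definition feasible_region :: "nat \<Rightarrow> (nat list \<Rightarrow> real) set" where
  "feasible_region k = {v. supp_in k v \<and> (\<forall>p\<in>perms k. 0 \<le> v p \<and> v p \<le> 1) \<and>
     (\<exists>\<s>::nat \<Rightarrow> nat list. (\<forall>m. \<s> m \<in> perms (length (\<s> m))) \<and>
        filterlim (\<lambda>m. length (\<s> m)) at_top sequentially \<and>
        (\<forall>p\<in>perms k. (\<lambda>m. cocc_prop p (\<s> m)) \<longlonglongrightarrow> v p))}"

definition be :: "nat list \<Rightarrow> nat list" where
  "be p = std (butlast p)"

definition en :: "nat list \<Rightarrow> nat list" where
  "en p = std (tl p)"

text \<open>General directed multigraphs: edge set E, start map st, arrival map ar.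
  Walks are lists of edges.\<close>
definition is_walk :: "'e set \<Rightarrow> ('e \<Rightarrow> 'v) \<Rightarrow> ('e \<Rightarrow> 'v) \<Rightarrow> 'e list \<Rightarrow> bool" where
  "is_walk E st ar es \<longleftrightarrow> set es \<subseteq> E \<and>
     (\<forall>i. Suc i < length es \<longrightarrow> ar (es ! i) = st (es ! Suc i))"

definition is_cycle :: "'e set \<Rightarrow> ('e \<Rightarrow> 'v) \<Rightarrow> ('e \<Rightarrow> 'v) \<Rightarrow> 'e list \<Rightarrow> bool" where
  "is_cycle E st ar es \<longleftrightarrow> is_walk E st ar es \<and> (es \<noteq> [] \<longrightarrow> st (hd es) = ar (last es))"

text \<open>Vertex sequence st(e_1), ar(e_1), ..., ar(e_s); a path has distinct edges and
  distinct vertices except possibly the first and the last one.\<close>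
definition is_path :: "'e set \<Rightarrow> ('e \<Rightarrow> 'v) \<Rightarrow> ('e \<Rightarrow> 'v) \<Rightarrow> 'e list \<Rightarrow> bool" where
  "is_path E st ar es \<longleftrightarrow> is_walk E st ar es \<and> distinct es \<and>
     (es \<noteq> [] \<longrightarrow> (let vs = st (hd es) # map ar es in distinct (butlast vs) \<and> distinct (tl vs)))"

definition simple_cycle :: "'e set \<Rightarrow> ('e \<Rightarrow> 'v) \<Rightarrow> ('e \<Rightarrow> 'v) \<Rightarrow> 'e list \<Rightarrow> bool" where
  "simple_cycle E st ar es \<longleftrightarrow> es \<noteq> [] \<and> is_cycle E st ar es \<and> is_path E st ar es"

definition cycle_vec :: "'e list \<Rightarrow> ('e \<Rightarrow> real)" where
  "cycle_vec es = (\<lambda>e. real (count_list es e) / real (length es))"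

definition conv :: "('e \<Rightarrow> real) set \<Rightarrow> ('e \<Rightarrow> real) set" where
  "conv S = {v. \<exists>n (c::nat \<Rightarrow> real) x. (\<forall>i<n. 0 \<le> c i \<and> x i \<in> S) \<and> (\<Sum>i<n. c i) = 1 \<and>
                 v = (\<lambda>e. \<Sum>i<n. c i * x i e)}"

definition cycle_polytope :: "'e set \<Rightarrow> ('e \<Rightarrow> 'v) \<Rightarrow> ('e \<Rightarrow> 'v) \<Rightarrow> ('e \<Rightarrow> real) set" where
  "cycle_polytope E st ar = conv {cycle_vec C | C. simple_cycle E st ar C}"

definition vertices :: "('e \<Rightarrow> real) set \<Rightarrow> ('e \<Rightarrow> real) set" where
  "vertices S = {x \<in> S. \<forall>a\<in>S. \<forall>b\<in>S. \<forall>t::real. 0 < t \<and> t < 1 \<and>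
                   x = (\<lambda>e. t * a e + (1 - t) * b e) \<longrightarrow> a = b}"

definition aff_indep :: "('e \<Rightarrow> real) list \<Rightarrow> bool" where
  "aff_indep xs \<longleftrightarrow> (\<forall>c::nat \<Rightarrow> real. (\<Sum>i<length xs. c i) = 0 \<and>
       (\<lambda>e. \<Sum>i<length xs. c i * (xs ! i) e) = (\<lambda>_. 0) \<longrightarrow> (\<forall>i<length xs. c i = 0))"

definition has_aff_dim :: "('e \<Rightarrow> real) set \<Rightarrow> nat \<Rightarrow> bool" where
  "has_aff_dim S d \<longleftrightarrow> (\<exists>xs. length xs = d + 1 \<and> set xs \<subseteq> S \<and> aff_indep xs) \<and>
     (\<forall>xs. set xs \<subseteq> S \<and> aff_indep xs \<longrightarrow> length xs \<le> d + 1)"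

end

theory Submission
  imports Defs "HOL-Combinatorics.Multiset_Permutations"
begin

text \<open>
  All descriptions agree with the polytope of nonnegative circulations of total mass 1 on the
  overlap graph. Every nonnegative circulation decomposes into simple cycles, by repeatedly
  subtracting a cycle from its support, and a circulation supported on one simple cycle is
  constant there, so that the cycle vectors are exactly the vertices. The dimension is obtained
  from a spanning tree; that the polytope has full dimension in the space of circulations follows
  from the uniform vector, which is a circulation because \<open>en p = be (rotate1 p)\<close>.

  Limits of pattern densities are circulations because the windows of length \<open>k - 1\<close> are
  the beginnings and also the ends of the windows of length \<open>k\<close>, up to one boundary window.
  Conversely, every walk in the overlap graph is realized by a sequence of distinct reals, extended
  one value at a time by density of the order; repeating each cycle of a convex combination
  proportionally to its weight and concatenating the resulting sequences gives the required densities.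
\<close>

section \<open>Circulations in a finite directed multigraph\<close>

text \<open>Reading indices modulo \<open>length es\<close> turns the closing condition into one
  more consecutive condition. The arrivals are then the starts shifted cyclically by one, so both
  lists have the same multiplicities.\<close>

lemma cycle_iff_rotate1:
  assumes "es \<noteq> []"
  shows "is_cycle E st ar es \<longleftrightarrow> set es \<subseteq> E \<and> map ar es = rotate1 (map st es)"
proof -
  have L: "length es > 0" using assms by simp
  have "(map ar es = rotate1 (map st es)) \<longleftrightarrow>
      (\<forall>i<length es. ar (es ! i) = st (es ! (Suc i mod length es)))"
  proof -
    have "rotate1 (map st es) ! i = st (es ! (Suc i mod length es))" if "i < length es" for i
      using that mod_less_divisor[OF L, of "Suc i"] by (simp only: nth_rotate1 length_map nth_map)
    then show ?thesis unfolding list_eq_iff_nth_eq[of "map ar es"] by auto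
  qed
  also have "\<dots> \<longleftrightarrow> (\<forall>i. Suc i < length es \<longrightarrow> ar (es ! i) = st (es ! Suc i)) \<and> st (hd es) = ar (last es)"
    (is "?l \<longleftrightarrow> ?r")
  proof
    assume ?l
    then have "ar (es ! (length es - 1)) = st (es ! (Suc (length es - 1) mod length es))"
      using L by simp
    then have "st (hd es) = ar (last es)"
      using assms L by (simp add: hd_conv_nth last_conv_nth)
    moreover have "\<forall>i. Suc i < length es \<longrightarrow> ar (es ! i) = st (es ! Suc i)"
      using \<open>?l\<close> by simp
    ultimately show ?r by blast
  next
    assume r: ?r
    show ?l
    proof (intro allI impI)
      fix i assume i: "i < length es"
      show "ar (es ! i) = st (es ! (Suc i mod length es))"
      proof (cases "Suc i < length es")
        case True then show ?thesis using r by simp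
      next
        case False
        then have "length es = Suc i" using i by simp
        then show ?thesis using r assms by (simp add: hd_conv_nth last_conv_nth)
      qed
    qed
  qed
  finally show ?thesis
    using assms unfolding is_cycle_def is_walk_def by auto
qed

text \<open>When the arrivals are the rotated starts, the vertex sequence is
  \<open>map st es\<close> followed by the first start again. Both distinctness clauses of
  \<open>is_path\<close> then say that the starts are distinct, and this also makes the edges
  distinct.\<close>

lemma simple_cycle_iff:
  "simple_cycle E st ar es \<longleftrightarrow>
     es \<noteq> [] \<and> set es \<subseteq> E \<and> distinct (map st es) \<and> map ar es = rotate1 (map st es)"
proof (cases es)
  case Nil then show ?thesis by (simp add: simple_cycle_def)
next
  case (Cons e es')
  have ne: "es \<noteq> []" using Cons by simp
  have "is_path E st ar es \<longleftrightarrow> is_walk E st ar es \<and> distinct (map st es)"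
    if "map ar es = rotate1 (map st es)"
  proof -
    have "st (hd es) # map ar es = map st es @ [st e]" using that Cons by simp
    moreover have "tl (map st es @ [st e]) = rotate1 (map st es)" using Cons by simp
    ultimately show ?thesis
      using ne unfolding is_path_def Let_def by (auto simp: distinct_map)
  qed
  then show ?thesis
    using cycle_iff_rotate1[OF ne, of E st ar] ne
    unfolding simple_cycle_def is_cycle_def by blast
qed

definition cycle_vecs :: "'e set \<Rightarrow> ('e \<Rightarrow> 'v) \<Rightarrow> ('e \<Rightarrow> 'v) \<Rightarrow> ('e \<Rightarrow> real) set" where
  "cycle_vecs E st ar = {cycle_vec C | C. simple_cycle E st ar C}"

text \<open>For \<open>f\<close> equal to \<open>st\<close> or \<open>ar\<close> this expresses the
  outflow or inflow of a cycle by vertex multiplicities; for constant \<open>f\<close> it gives the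
  total mass.\<close>

lemma sum_count_list_fibre:
  assumes "finite E" "set es \<subseteq> E"
  shows "(\<Sum>e\<in>{e\<in>E. f e = x}. count_list es e) = count_list (map f es) x"
  using assms(2)
proof (induction es)
  case (Cons a es)
  have "(\<Sum>e\<in>{e\<in>E. f e = x}. count_list (a # es) e)
      = (\<Sum>e\<in>{e\<in>E. f e = x}. count_list es e + (if e = a then 1 else 0))"
    by (intro sum.cong) auto
  also have "\<dots> = count_list (map f es) x + (\<Sum>e\<in>{e\<in>E. f e = x}. (if e = a then 1 else 0))"
    using Cons by (simp add: sum.distrib)
  also have "(\<Sum>e\<in>{e\<in>E. f e = x}. (if e = a then 1 else 0)) = (if f a = x then 1 else (0::nat))"
    using Cons assms(1) by (subst sum.delta) auto
  finally show ?case by simp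
qed simp

lemma count_list_rotate1: "count_list (rotate1 xs) x = count_list xs x"
  by (cases xs) simp_all

section \<open>Linear dependence and extreme points of a convex hull\<close>

text \<open>Gaussian elimination: a homogeneous system with fewer equations (\<open>N\<close>) than
  unknowns (\<open>I\<close>) has a nontrivial solution.\<close>

lemma nontrivial_kernel:
  fixes a :: "'i \<Rightarrow> 'e \<Rightarrow> real"
  assumes "finite N" "finite I" "card N < card I"
  shows "\<exists>c. (\<exists>i\<in>I. c i \<noteq> 0) \<and> (\<forall>e\<in>N. (\<Sum>i\<in>I. c i * a i e) = 0)"
  using assms
proof (induction N arbitrary: I a rule: finite_induct)
  case empty
  then obtain i where "i \<in> I" by (metis card.empty card_gt_0_iff ex_in_conv)
  then show ?case by (intro exI[of _ "\<lambda>_. 1"]) auto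
next
  case (insert e N)
  show ?case
  proof (cases "\<forall>i\<in>I. a i e = 0")
    case True
    have "card N < card I" using insert by simp
    then obtain c where "\<exists>i\<in>I. c i \<noteq> 0" "\<forall>e\<in>N. (\<Sum>i\<in>I. c i * a i e) = 0"
      using insert.IH[OF insert.prems(1)] by blast
    then show ?thesis using True by (intro exI[of _ c]) simp
  next
    case False
    then obtain j where j: "j \<in> I" "a j e \<noteq> 0" by blast
    \<comment> \<open>The unknown \<open>j\<close> is the pivot of equation \<open>e\<close>;
      eliminating it leaves one equation and one unknown less.\<close>
    define J where "J = I - {j}"
    have J: "finite J" "card N < card J" "j \<notin> J" "I = insert j J"
      using insert j by (auto simp: J_def)
    obtain c where c: "\<exists>i\<in>J. c i \<noteq> 0"
      and c0: "\<forall>e'\<in>N. (\<Sum>i\<in>J. c i * (a i e' - a i e / a j e * a j e')) = 0"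
      using insert.IH[OF J(1,2), of "\<lambda>i e'. a i e' - a i e / a j e * a j e'"] by blast
    define s where "s = (\<Sum>i\<in>J. c i * a i e)"
    \<comment> \<open>The pivot coefficient is the one that solves equation
      \<open>e\<close>.\<close>
    define c' where "c' = c(j := - s / a j e)"
    have split: "(\<Sum>i\<in>I. c' i * a i e') = - s / a j e * a j e' + (\<Sum>i\<in>J. c i * a i e')" for e'
    proof -
      have "(\<Sum>i\<in>J. c' i * a i e') = (\<Sum>i\<in>J. c i * a i e')"
        using J(3) by (intro sum.cong) (auto simp: c'_def)
      then show ?thesis using J by (simp add: c'_def)
    qed
    have "(\<Sum>i\<in>I. c' i * a i e') = 0" if "e' \<in> N" for e'
    proof -
      have "(\<Sum>i\<in>J. c i * (a i e' - a i e / a j e * a j e'))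
          = (\<Sum>i\<in>J. c i * a i e') - s / a j e * a j e'"
        unfolding s_def sum_divide_distrib sum_distrib_right
        by (simp add: sum_subtractf[symmetric] algebra_simps)
      then show ?thesis using c0 that split by simp
    qed
    moreover have "(\<Sum>i\<in>I. c' i * a i e) = 0"
      using split[of e] j by (simp add: s_def)
    moreover have "\<exists>i\<in>I. c' i \<noteq> 0"
      using c J by (auto simp: c'_def)
    ultimately show ?thesis by (intro exI[of _ c']) simp
  qed
qed

text \<open>A generator of positive weight below 1 can be split off, writing the vertex as a proper
  combination of that generator and the rescaled rest. Extremality identifies the two, so the vertex
  is the generator.\<close>

lemma vertices_conv_subset: "vertices (conv S) \<subseteq> S"
proof
  fix v assume v: "v \<in> vertices (conv S)"
  then obtain n :: nat and c :: "nat \<Rightarrow> real" and x where cx: "\<forall>i<n. 0 \<le> c i \<and> x i \<in> S" and c1: "(\<Sum>i<n. c i) = (1::real)"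
    and v_eq: "v = (\<lambda>e. \<Sum>i<n. c i * x i e)"
    unfolding vertices_def conv_def by blast
  have "\<exists>i<n. c i \<noteq> 0"
  proof (rule ccontr)
    assume "\<not> ?thesis"
    then have "(\<Sum>i<n. c i) = 0" by (intro sum.neutral) simp
    then show False using c1 by simp
  qed
  then obtain i where i: "i < n" "c i \<noteq> 0" by blast
  then have ci: "c i > 0" using cx by (simp add: less_le)
  have split: "(\<Sum>j<n. g j) = g i + (\<Sum>j\<in>{..<n}-{i}. g j)" for g :: "nat \<Rightarrow> real"
    using i by (simp add: sum.remove)
  have rest: "(\<Sum>j\<in>{..<n}-{i}. c j) = 1 - c i" using split[of c] c1 by simp
  have rest_nonneg: "0 \<le> (\<Sum>j\<in>{..<n}-{i}. c j)" using cx by (intro sum_nonneg) auto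
  have xi: "x i \<in> conv S"
    unfolding conv_def using cx i by (auto intro!: exI[of _ "1::nat"] exI[of _ "\<lambda>_. 1::real"] exI[of _ "\<lambda>_. x i"])
  show "v \<in> S"
  proof (cases "c i = 1")
    case True
    then have "c j = 0" if "j \<in> {..<n}-{i}" for j
      using rest that cx sum_nonneg_eq_0_iff[of "{..<n}-{i}" c] by auto
    then have "v = x i"
      unfolding v_eq using True by (auto simp: split)
    then show ?thesis using cx i by simp
  next
    case False
    then have lt: "c i < 1" using rest rest_nonneg by simp
    \<comment> \<open>The other weights, rescaled to sum 1; index \<open>i\<close> stays with weight
      0 so that the index range is unchanged.\<close>
    define d where "d = (\<lambda>j. if j = i then 0 else c j / (1 - c i))"
    define y where "y = (\<lambda>e. \<Sum>j<n. d j * x j e)"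
    have sum_d: "(\<Sum>j<n. d j * g j) = (\<Sum>j\<in>{..<n}-{i}. c j * g j) / (1 - c i)" for g :: "nat \<Rightarrow> real"
    proof -
      have "(\<Sum>j<n. d j * g j) = (\<Sum>j\<in>{..<n}-{i}. d j * g j)"
        by (subst split) (simp add: d_def)
      also have "\<dots> = (\<Sum>j\<in>{..<n}-{i}. c j * g j / (1 - c i))"
        by (intro sum.cong) (auto simp: d_def)
      finally show ?thesis by (simp add: sum_divide_distrib)
    qed
    have "(\<Sum>j<n. d j) = 1" using sum_d[of "\<lambda>_. 1"] rest lt by simp
    moreover have "\<forall>j<n. 0 \<le> d j \<and> x j \<in> S" using cx lt by (auto simp: d_def)
    ultimately have "y \<in> conv S" unfolding conv_def y_def by blast
    moreover have v_y: "v = (\<lambda>e. c i * x i e + (1 - c i) * y e)"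
    proof
      fix e
      have "(1 - c i) * y e = (\<Sum>j\<in>{..<n}-{i}. c j * x j e)"
        using lt by (simp add: y_def sum_d)
      then show "v e = c i * x i e + (1 - c i) * y e" unfolding v_eq by (simp add: split)
    qed
    ultimately have "x i = y" using v xi ci lt unfolding vertices_def by blast
    with v_y have "v = x i" by (auto simp: algebra_simps)
    then show ?thesis using cx i by simp
  qed
qed

section \<open>Circulations and their decomposition into simple cycles\<close>

locale finite_digraph =
  fixes V :: "'v set" and E :: "'e set" and st ar :: "'e \<Rightarrow> 'v"
  assumes finite_V: "finite V" and finite_E: "finite E"
    and st_in: "e \<in> E \<Longrightarrow> st e \<in> V" and ar_in: "e \<in> E \<Longrightarrow> ar e \<in> V"
begin

text \<open>Net outflow; its vanishing is Kirchhoff's law at \<open>x\<close>.\<close>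

definition excess :: "('e \<Rightarrow> real) \<Rightarrow> 'v \<Rightarrow> real" where
  "excess v x = (\<Sum>e\<in>{e\<in>E. st e = x}. v e) - (\<Sum>e\<in>{e\<in>E. ar e = x}. v e)"

text \<open>Vanishing off \<open>E\<close> makes equality of functions the same as equality in the
  coordinate space of the edges.\<close>

definition circulation :: "('e \<Rightarrow> real) \<Rightarrow> bool" where
  "circulation v \<longleftrightarrow> (\<forall>e. e \<notin> E \<longrightarrow> v e = 0) \<and> (\<forall>x\<in>V. excess v x = 0)"

definition flow_polytope :: "('e \<Rightarrow> real) set" where
  "flow_polytope = {v. circulation v \<and> (\<forall>e\<in>E. 0 \<le> v e) \<and> sum v E = 1}"

lemma excess_add: "excess (\<lambda>e. v e + w e) x = excess v x + excess w x"
  by (simp add: excess_def sum.distrib)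

lemma excess_scale: "excess (\<lambda>e. c * v e) x = c * excess v x"
  by (simp add: excess_def sum_distrib_left right_diff_distrib)

lemma excess_sum: "excess (\<lambda>e. \<Sum>i\<in>I. c i * v i e) x = (\<Sum>i\<in>I. c i * excess (v i) x)"
  unfolding excess_def
  by (subst (1 2) sum.swap) (simp add: sum_subtractf sum_distrib_left right_diff_distrib)

lemma excess_indicator:
  assumes "e \<in> E"
  shows "excess (\<lambda>e'. of_bool (e' = e)) x = of_bool (st e = x) - of_bool (ar e = x)"
proof -
  have "(\<Sum>e'\<in>{e'\<in>E. f e' = x}. of_bool (e' = e)) = (of_bool (f e = x) :: real)" for f :: "'e \<Rightarrow> 'v"
    using finite_E assms by (auto simp: of_bool_def sum.delta)
  then show ?thesis by (simp add: excess_def)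
qed

lemma circulation_sum:
  assumes "\<And>i. i \<in> I \<Longrightarrow> circulation (v i)"
  shows "circulation (\<lambda>e. \<Sum>i\<in>I. c i * v i e)"
  using assms by (auto simp: circulation_def excess_sum intro!: sum.neutral)

lemma circulation_add:
  "circulation v \<Longrightarrow> circulation w \<Longrightarrow> circulation (\<lambda>e. a * v e + b * w e)"
  by (simp add: circulation_def excess_add excess_scale)

text \<open>The arrivals are a rotation of the starts, so every vertex is left as often as it is
  entered.\<close>

lemma simple_cycle_in_flow_polytope:
  assumes "simple_cycle E st ar es"
  shows "cycle_vec es \<in> flow_polytope"
proof -
  have es: "es \<noteq> []" "set es \<subseteq> E" "map ar es = rotate1 (map st es)"
    using assms by (auto simp: simple_cycle_iff)
  have "excess (cycle_vec es) x = 0" for x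
    using es sum_count_list_fibre[OF finite_E es(2), of st x, symmetric]
      sum_count_list_fibre[OF finite_E es(2), of ar x, symmetric]
    by (simp add: excess_def cycle_vec_def sum_divide_distrib[symmetric] of_nat_sum[symmetric]
        count_list_rotate1 del: of_nat_sum)
  moreover have "cycle_vec es e = 0" if "e \<notin> E" for e
    using that es by (auto simp: cycle_vec_def count_list_0_iff)
  moreover have "sum (cycle_vec es) E = 1"
    using es finite_E sum_count_list_fibre[OF finite_E es(2), of "\<lambda>_. ()" "()"]
    by (simp add: cycle_vec_def sum_divide_distrib[symmetric] of_nat_sum[symmetric] del: of_nat_sum)
      (simp add: count_list_eq_length_filter)
  ultimately show ?thesis
    by (auto simp: flow_polytope_def circulation_def cycle_vec_def)
qed

lemma conv_subset_flow_polytope: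
  assumes "S \<subseteq> flow_polytope"
  shows "conv S \<subseteq> flow_polytope"
proof
  fix v assume "v \<in> conv S"
  then obtain n :: nat and c :: "nat \<Rightarrow> real" and x where cx: "\<forall>i<n. 0 \<le> c i \<and> x i \<in> S" and c1: "(\<Sum>i<n. c i) = (1::real)"
    and v: "v = (\<lambda>e. \<Sum>i<n. c i * x i e)"
    unfolding conv_def by blast
  have x: "circulation (x i)" "\<And>e. e \<in> E \<Longrightarrow> 0 \<le> x i e" "sum (x i) E = 1" if "i < n" for i
    using cx that assms by (auto simp: flow_polytope_def)
  have "sum v E = (\<Sum>i<n. c i * sum (x i) E)"
    unfolding v by (subst sum.swap) (simp add: sum_distrib_left)
  also have "\<dots> = 1" using x c1 by simp
  finally have "sum v E = 1" .
  moreover have "circulation v" unfolding v using x by (intro circulation_sum) auto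
  moreover have "0 \<le> v e" if "e \<in> E" for e
    unfolding v using x cx that by (intro sum_nonneg) auto
  ultimately show "v \<in> flow_polytope" by (simp add: flow_polytope_def)
qed

text \<open>By conservation, an edge of positive flow is followed by another one. Following such
  edges in a finite graph eventually repeats a vertex, and the first repetition closes a simple
  cycle.\<close>

lemma support_contains_simple_cycle:
  assumes v: "circulation v" "\<And>e. e \<in> E \<Longrightarrow> 0 \<le> v e" and e0: "e0 \<in> E" "v e0 > 0"
  obtains es where "simple_cycle E st ar es" "\<And>e. e \<in> set es \<Longrightarrow> v e > 0"
proof -
  define P where "P = {e\<in>E. v e > 0}"
  have "\<exists>e'\<in>P. st e' = ar e" if "e \<in> P" for e
  proof (rule ccontr)
    assume "\<not> ?thesis"
    then have "(\<Sum>e'\<in>{e'\<in>E. st e' = ar e}. v e') \<le> 0"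
      unfolding P_def by (intro sum_nonpos) (auto simp: not_less)
    moreover have "v e \<le> (\<Sum>e'\<in>{e'\<in>E. ar e' = ar e}. v e')"
      using finite_E v that by (intro member_le_sum) (auto simp: P_def)
    moreover have "excess v (ar e) = 0"
      using v that ar_in by (auto simp: circulation_def P_def)
    ultimately show False using that by (simp add: excess_def P_def)
  qed
  then obtain nxt where nxt: "\<And>e. e \<in> P \<Longrightarrow> nxt e \<in> P \<and> st (nxt e) = ar e" by metis
  define w where "w i = (nxt ^^ i) e0" for i
  have wP: "w i \<in> P" for i
    by (induction i) (use e0 nxt in \<open>auto simp: w_def P_def\<close>)
  have w_step: "ar (w i) = st (w (Suc i))" for i
    using nxt[OF wP[of i]] by (simp add: w_def)
  have "\<not> inj (\<lambda>i. st (w i))"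
  proof
    assume "inj (\<lambda>i. st (w i))"
    moreover have "range (\<lambda>i. st (w i)) \<subseteq> V" using wP st_in by (auto simp: P_def)
    ultimately show False using finite_V
      by (metis finite_imageD finite_subset infinite_UNIV_nat)
  qed
  then have ex: "\<exists>j. \<exists>i<j. st (w i) = st (w j)"
    unfolding inj_def by (metis linorder_neqE_nat)
  \<comment> \<open>Minimality of \<open>j\<close> makes all starts before \<open>j\<close>
    distinct, so the segment from \<open>i\<close> to \<open>j\<close> is simple.\<close>
  define j where "j = (LEAST j. \<exists>i<j. st (w i) = st (w j))"
  obtain i where i: "i < j" "st (w i) = st (w j)"
    using LeastI_ex[OF ex] unfolding j_def by blast
  have inj: "st (w a) \<noteq> st (w b)" if "a < b" "b < j" for a b
    using not_less_Least[of b "\<lambda>j. \<exists>i<j. st (w i) = st (w j)"] that unfolding j_def by blast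
  define es where "es = map w [i..<j]"
  have len: "length es = j - i" by (simp add: es_def)
  have "distinct (map st es)"
    unfolding es_def map_map distinct_map
    by (auto intro!: linorder_inj_onI dest: inj)
  moreover have "map ar es = rotate1 (map st es)"
  proof (rule nth_equalityI)
    fix a assume "a < length (map ar es)"
    then have a: "a < j - i" by (simp add: len)
    show "map ar es ! a = rotate1 (map st es) ! a"
    proof (cases "Suc a = j - i")
      case True
      then have "Suc (i + a) = j" using i by simp
      then show ?thesis using a i True w_step[of "i + a"]
        by (simp add: nth_rotate1 len) (simp add: es_def)
    next
      case False
      then have "Suc a < j - i" using a by simp
      then show ?thesis using a w_step[of "i + a"]
        by (simp add: nth_rotate1 len) (simp add: es_def)
    qed
  qed simp
  moreover have "es \<noteq> []" "set es \<subseteq> P" using i wP by (auto simp: es_def)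
  ultimately show thesis
    using that[of es] by (auto simp: simple_cycle_iff P_def)
qed

lemma cycle_vec_simple:
  assumes "simple_cycle E st ar es"
  shows "cycle_vec es e = of_bool (e \<in> set es) / real (length es)"
  using assms
  by (auto simp: simple_cycle_iff cycle_vec_def distinct_map count_list_0_iff count_list_eq_length_filter
      distinct_length_filter)

text \<open>Induction on the number of edges with positive flow: subtracting the minimum over a
  cycle in the support keeps the flow nonnegative and removes at least one edge from the
  support.\<close>

lemma flow_decomposition:
  assumes "circulation v" "\<And>e. e \<in> E \<Longrightarrow> 0 \<le> v e"
  shows "\<exists>n c x. (\<forall>i<(n::nat). 0 \<le> c i \<and> x i \<in> cycle_vecs E st ar) \<and> v = (\<lambda>e. \<Sum>i<n. c i * x i e)"
  using assms
proof (induction "card {e\<in>E. v e > 0}" arbitrary: v rule: less_induct)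
  case less
  show ?case
  proof (cases "\<exists>e0\<in>E. v e0 > 0")
    case False
    then have "v = (\<lambda>_. 0)"
      using less.prems by (metis antisym_conv2 circulation_def)
    then show ?thesis by (intro exI[of _ 0]) auto
  next
    case True
    then obtain es where es: "simple_cycle E st ar es" and pos: "\<And>e. e \<in> set es \<Longrightarrow> v e > 0"
      using support_contains_simple_cycle less.prems by metis
    have es': "es \<noteq> []" "set es \<subseteq> E" using es by (auto simp: simple_cycle_iff)
    define \<mu> where "\<mu> = Min (v ` set es)"
    have "\<mu> \<in> v ` set es" unfolding \<mu>_def using es' by (intro Min_in) auto
    then obtain e1 where e1: "e1 \<in> set es" "v e1 = \<mu>" by auto
    have \<mu>_le: "\<mu> \<le> v e" if "e \<in> set es" for e unfolding \<mu>_def using that by simp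
    have \<mu>_pos: "\<mu> > 0" using e1 pos by auto
    \<comment> \<open>\<open>cycle_vec es\<close> is \<open>1 / length es\<close> on its edges, so
      this factor subtracts exactly \<mu>.\<close>
    define w where "w = (\<lambda>e. 1 * v e + - (\<mu> * length es) * cycle_vec es e)"
    have w_eq: "w e = v e - \<mu> * of_bool (e \<in> set es)" for e
      using es' by (simp add: w_def cycle_vec_simple[OF es])
    have "circulation w"
      unfolding w_def using less.prems simple_cycle_in_flow_polytope[OF es]
      by (intro circulation_add) (auto simp: flow_polytope_def)
    moreover have "0 \<le> w e" if "e \<in> E" for e
      using \<mu>_le[of e] less.prems(2)[OF that] by (simp add: w_eq of_bool_def)
    moreover have "card {e\<in>E. w e > 0} < card {e\<in>E. v e > 0}"
    proof (rule psubset_card_mono)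
      have "e1 \<in> {e\<in>E. v e > 0}" "e1 \<notin> {e\<in>E. w e > 0}" using e1 es' pos by (auto simp: w_eq)
      moreover have "{e\<in>E. w e > 0} \<subseteq> {e\<in>E. v e > 0}"
        using \<mu>_pos by (auto simp: w_eq of_bool_def split: if_splits)
      ultimately show "{e\<in>E. w e > 0} \<subset> {e\<in>E. v e > 0}" by blast
    qed (use finite_E in simp)
    ultimately obtain n :: nat and c :: "nat \<Rightarrow> real" and x where
      cx: "\<forall>i<(n::nat). 0 \<le> c i \<and> x i \<in> cycle_vecs E st ar" and w: "w = (\<lambda>e. \<Sum>i<n. c i * x i e)"
      using less.hyps[of w] by blast
    define c' where "c' = c(n := \<mu> * length es)"
    define x' where "x' = x(n := cycle_vec es)"
    have "v e = (\<Sum>i<Suc n. c' i * x' i e)" for e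
    proof -
      have "(\<Sum>i<n. c' i * x' i e) = w e" unfolding w by (auto simp: c'_def x'_def)
      then show ?thesis by (simp add: w_def) (simp add: c'_def x'_def)
    qed
    moreover have "\<forall>i<Suc n. 0 \<le> c' i \<and> x' i \<in> cycle_vecs E st ar"
      using cx es \<mu>_pos by (auto simp: c'_def x'_def less_Suc_eq cycle_vecs_def)
    ultimately show ?thesis by blast
  qed
qed

lemma flow_polytope_eq_cycle_polytope: "flow_polytope = cycle_polytope E st ar"
proof
  have "cycle_vecs E st ar \<subseteq> flow_polytope"
    using simple_cycle_in_flow_polytope by (auto simp: cycle_vecs_def)
  then show "cycle_polytope E st ar \<subseteq> flow_polytope"
    unfolding cycle_polytope_def cycle_vecs_def[symmetric] by (rule conv_subset_flow_polytope)
  show "flow_polytope \<subseteq> cycle_polytope E st ar"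
  proof
    fix v assume v: "v \<in> flow_polytope"
    then obtain n :: nat and c :: "nat \<Rightarrow> real" and x where cx: "\<forall>i<(n::nat). 0 \<le> c i \<and> x i \<in> cycle_vecs E st ar"
      and v_eq: "v = (\<lambda>e. \<Sum>i<n. c i * x i e)"
      using flow_decomposition[of v] by (auto simp: flow_polytope_def)
    \<comment> \<open>Every cycle vector has mass 1, so total mass 1 forces the conic coefficients
      to be convex ones.\<close>
    have "sum v E = (\<Sum>i<n. c i * sum (x i) E)"
      unfolding v_eq by (subst sum.swap) (simp add: sum_distrib_left)
    also have "\<dots> = (\<Sum>i<n. c i)"
      using cx \<open>cycle_vecs E st ar \<subseteq> flow_polytope\<close>
      by (intro sum.cong) (auto simp: flow_polytope_def)
    finally have "(\<Sum>i<n. c i) = 1" using v by (simp add: flow_polytope_def)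
    then show "v \<in> cycle_polytope E st ar"
      unfolding cycle_polytope_def cycle_vecs_def[symmetric] conv_def using cx v_eq by blast
  qed
qed

section \<open>Vertices of the flow polytope\<close>

text \<open>At each vertex of the cycle only one edge of \<open>es\<close> enters and only one
  leaves. Conservation makes the flow constant along the cycle, and total mass 1 fixes the
  constant.\<close>

lemma circulation_on_simple_cycle:
  assumes es: "simple_cycle E st ar es" and v: "v \<in> flow_polytope"
    and supp: "\<And>e. e \<notin> set es \<Longrightarrow> v e = 0"
  shows "v = cycle_vec es"
proof -
  have es': "es \<noteq> []" "set es \<subseteq> E" "distinct (map st es)" "map ar es = rotate1 (map st es)"
    using es by (auto simp: simple_cycle_iff)
  then have dist_ar: "distinct (map ar es)" by simp
  have fibre: "(\<Sum>e\<in>{e\<in>E. f e = f e0}. v e) = v e0"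
    if "distinct (map f es)" "e0 \<in> set es" for e0 and f :: "'e \<Rightarrow> 'v"
  proof -
    have "inj_on f (set es)" using that(1) by (simp add: distinct_map)
    then have "(\<Sum>e\<in>{e\<in>E. f e = f e0}. v e) = (\<Sum>e\<in>{e0}. v e)"
      using that es'(2) finite_E supp by (intro sum.mono_neutral_right) (auto dest: inj_onD)
    then show ?thesis by simp
  qed
  have step: "v (es ! Suc i) = v (es ! i)" if "Suc i < length es" for i
  proof -
    have "map ar es ! i = rotate1 (map st es) ! i" using es' by simp
    then have eq: "ar (es ! i) = st (es ! Suc i)" using that by (simp add: nth_rotate1)
    have mem: "es ! i \<in> set es" "es ! Suc i \<in> set es" using that by simp_all
    then have "excess v (ar (es ! i)) = 0"
      using v ar_in es'(2) by (auto simp: flow_polytope_def circulation_def)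
    then show ?thesis
      using fibre[OF es'(3) mem(2)] fibre[OF dist_ar mem(1)] by (simp add: excess_def eq)
  qed
  have const: "v (es ! i) = v (es ! 0)" if "i < length es" for i
    using that by (induction i) (auto simp: step)
  then obtain c where const': "v e = c" if "e \<in> set es" for e
    by (metis in_set_conv_nth)
  have "1 = sum v E" using v by (simp add: flow_polytope_def)
  also have "\<dots> = sum v (set es)"
    using supp es'(2) finite_E by (intro sum.mono_neutral_right) simp_all
  also have "\<dots> = real (length es) * c"
    using const' es' by (simp add: distinct_card distinct_map)
  finally have "c = 1 / real (length es)" using es' by (simp add: field_simps)
  then show ?thesis
    using const' supp by (auto simp: cycle_vec_simple[OF es])
qed

lemma vertices_flow_polytope: "vertices flow_polytope = {cycle_vec C | C. simple_cycle E st ar C}"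
proof
  show "vertices flow_polytope \<subseteq> {cycle_vec C | C. simple_cycle E st ar C}"
    unfolding flow_polytope_eq_cycle_polytope cycle_polytope_def by (rule vertices_conv_subset)
next
  show "{cycle_vec C | C. simple_cycle E st ar C} \<subseteq> vertices flow_polytope"
  proof safe
    fix es assume es: "simple_cycle E st ar es"
    have "a = b" if ab: "a \<in> flow_polytope" "b \<in> flow_polytope" and t: "0 < t" "t < (1::real)"
      and eq: "cycle_vec es = (\<lambda>e. t * a e + (1 - t) * b e)" for a b t
    proof -
      have nonneg: "0 \<le> w e" if "w \<in> flow_polytope" for w e
        using that by (cases "e \<in> E") (auto simp: flow_polytope_def circulation_def)
      \<comment> \<open>Off the cycle, two nonnegative terms add up to 0. So \<open>a\<close> and
        \<open>b\<close> live on the cycle, where the circulation of mass 1 is unique.\<close>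
      have "a e = 0 \<and> b e = 0" if "e \<notin> set es" for e
      proof -
        have "t * a e + (1 - t) * b e = 0"
          using fun_cong[OF eq, of e] that by (simp add: cycle_vec_def count_list_0_iff)
        moreover have "0 \<le> t * a e" "0 \<le> (1 - t) * b e" using nonneg ab t by simp_all
        ultimately have "t * a e = 0" "(1 - t) * b e = 0" by linarith+
        then show ?thesis using t by simp
      qed
      then show ?thesis using circulation_on_simple_cycle[OF es] ab by metis
    qed
    then show "cycle_vec es \<in> vertices flow_polytope"
      using simple_cycle_in_flow_polytope[OF es] unfolding vertices_def by blast
  qed
qed

section \<open>Dimension of the flow polytope\<close>

text \<open>The edges \<open>t v\<close> with \<open>v \<noteq> r\<close> form a spanning tree directed towards \<open>r\<close>. A circulation
  is determined by its values on the remaining edges, and these values are arbitrary.\<close>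

context
  fixes r :: 'v and t :: "'v \<Rightarrow> 'e" and m :: nat
  assumes r_in: "r \<in> V" and t_in: "v \<in> V \<Longrightarrow> t v \<in> E" and st_t: "v \<in> V \<Longrightarrow> st (t v) = v"
    and reach: "v \<in> V \<Longrightarrow> ((\<lambda>v. ar (t v)) ^^ m) v = r"
begin

text \<open>A nonzero tree edge leaving \<open>w\<close> must be balanced by a nonzero edge entering
  \<open>w\<close>, again a tree edge. Going back \<open>m\<close> steps gives a vertex whose tree
  path has not reached \<open>r\<close> after \<open>m\<close> steps, against
  \<open>reach\<close>.\<close>

lemma circulation_on_tree_eq_0:
  assumes f: "circulation f" and zero: "\<And>e. e \<in> E - t ` (V - {r}) \<Longrightarrow> f e = 0"
  shows "f = (\<lambda>_. 0)"
proof (rule ccontr)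
  assume "f \<noteq> (\<lambda>_. 0)"
  then obtain e where e: "f e \<noteq> 0" by auto
  then have "e \<in> E" using f by (auto simp: circulation_def)
  then obtain v where v: "v \<in> V - {r}" "e = t v" using zero e by blast
  have "\<exists>w\<in>V - {r}. f (t w) \<noteq> 0 \<and> ((\<lambda>v. ar (t v)) ^^ j) w = v" for j
  proof (induction j)
    case 0 then show ?case using v e by auto
  next
    case (Suc j)
    then obtain w where w: "w \<in> V - {r}" "f (t w) \<noteq> 0" "((\<lambda>v. ar (t v)) ^^ j) w = v" by blast
    have "f e = 0" if "e \<in> E" "st e = w" "e \<noteq> t w" for e
      using zero[of e] that st_t by (cases "e \<in> t ` (V - {r})") auto
    then have "(\<Sum>e\<in>{e\<in>E. st e = w}. f e) = (\<Sum>e\<in>{t w}. f e)"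
      using w t_in st_t finite_E by (intro sum.mono_neutral_right) auto
    moreover have "excess f w = 0" using f w by (auto simp: circulation_def)
    ultimately have "(\<Sum>e\<in>{e\<in>E. ar e = w}. f e) \<noteq> 0" using w by (simp add: excess_def)
    then obtain e' where e': "e' \<in> E" "ar e' = w" "f e' \<noteq> 0"
      by (metis (mono_tags, lifting) mem_Collect_eq sum.not_neutral_contains_not_neutral)
    then obtain w' where "w' \<in> V - {r}" "e' = t w'" using zero by blast
    then show ?case
      using e' w funpow_swap1[of "\<lambda>v. ar (t v)" j w'] by (intro bexI[of _ w']) simp_all
  qed
  from this[of m] show False using reach v by auto
qed

text \<open>\<open>h\<close> sends one unit from \<open>v\<close> to \<open>r\<close> along the tree
  path.\<close>

lemma tree_flow:
  assumes "v \<in> V" "((\<lambda>v. ar (t v)) ^^ j) v = r"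
  shows "\<exists>h. (\<forall>e. e \<notin> t ` (V - {r}) \<longrightarrow> h e = 0) \<and> (\<forall>x. excess h x = of_bool (v = x) - of_bool (r = x))"
  using assms
proof (induction j arbitrary: v)
  case 0
  then show ?case by (intro exI[of _ "\<lambda>_. 0"]) (auto simp: excess_def)
next
  case (Suc j)
  show ?case
  proof (cases "v = r")
    case True
    then show ?thesis by (intro exI[of _ "\<lambda>_. 0"]) (auto simp: excess_def)
  next
    case False
    have "ar (t v) \<in> V" "((\<lambda>v. ar (t v)) ^^ j) (ar (t v)) = r"
      using Suc.prems t_in ar_in funpow_swap1[of "\<lambda>v. ar (t v)" j v] by simp_all
    then obtain h where h: "\<forall>e. e \<notin> t ` (V - {r}) \<longrightarrow> h e = 0"
      "\<forall>x. excess h x = of_bool (ar (t v) = x) - of_bool (r = x)"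
      using Suc.IH by blast
    show ?thesis
      using h Suc.prems False t_in st_t
      by (intro exI[of _ "\<lambda>e. of_bool (e = t v) + h e"])
        (auto simp: excess_add excess_indicator)
  qed
qed

text \<open>One unit runs along \<open>e\<close> and on from its end to \<open>r\<close>; the unit
  flow from its start to \<open>r\<close> is subtracted, which cancels the excess at
  \<open>r\<close>.\<close>

lemma fundamental_circulation:
  assumes "e \<in> E"
  shows "\<exists>f. circulation f \<and> (\<forall>e'. e' \<notin> t ` (V - {r}) \<longrightarrow> f e' = of_bool (e' = e))"
proof -
  obtain h1 h2 where h: "\<forall>e. e \<notin> t ` (V - {r}) \<longrightarrow> h1 e = 0"
    "\<forall>x. excess h1 x = of_bool (st e = x) - of_bool (r = x)"
    "\<forall>e. e \<notin> t ` (V - {r}) \<longrightarrow> h2 e = 0"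
    "\<forall>x. excess h2 x = of_bool (ar e = x) - of_bool (r = x)"
    using tree_flow[OF st_in[OF assms] reach] tree_flow[OF ar_in[OF assms] reach] st_in ar_in assms
    by meson
  define f where "f = (\<lambda>e'. (of_bool (e' = e) + h2 e') + (- 1) * h1 e')"
  have "excess f x = 0" for x
    unfolding f_def excess_add excess_scale using h by (simp add: excess_indicator[OF assms])
  moreover have off_tree: "f e' = of_bool (e' = e)" if "e' \<notin> t ` (V - {r})" for e'
    using h that by (simp add: f_def)
  moreover have "f e' = 0" if "e' \<notin> E" for e'
  proof -
    have "e' \<notin> t ` (V - {r})" "e' \<noteq> e" using that t_in assms by blast+
    then show ?thesis using off_tree by simp
  qed
  ultimately show ?thesis unfolding circulation_def by blast
qed

text \<open>The coordinates on the non-tree edges \<open>N\<close> determine a circulation, which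
  bounds the number of affinely independent points by \<open>card N\<close>. Perturbing the positive
  point \<open>u\<close> by each fundamental circulation attains the bound.\<close>

lemma has_aff_dim_flow_polytope:
  assumes u: "u \<in> flow_polytope" and u_pos: "\<And>e. e \<in> E \<Longrightarrow> u e > 0"
  shows "has_aff_dim flow_polytope (card E - card V)"
proof -
  define N where "N = E - t ` (V - {r})"
  have inj: "inj_on t V" using st_t by (metis inj_onI)
  have fN: "finite N" using finite_E by (simp add: N_def)
  \<comment> \<open>\<open>t\<close> embeds \<open>V\<close> into \<open>E\<close>, so
    \<open>card E - card V\<close> is not truncated.\<close>
  have "card (t ` V) \<le> card E" using t_in finite_E by (intro card_mono) auto
  then have le: "card V \<le> card E" using inj by (simp add: card_image)
  have "card (t ` (V - {r})) = card V - 1"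
    using inj r_in finite_V by (subst card_image) (auto intro: inj_on_subset)
  moreover have "card V > 0" using r_in finite_V card_gt_0_iff by blast
  moreover have "card N = card E - card (t ` (V - {r}))"
    unfolding N_def using t_in finite_V by (intro card_Diff_subset) auto
  ultimately have cardN: "card N = card E - card V + 1" using le by simp
  have upper: "length xs \<le> card N" if xs: "set xs \<subseteq> flow_polytope" "aff_indep xs" for xs
  proof (rule ccontr)
    assume "\<not> ?thesis"
    then obtain c where c: "\<exists>i\<in>{..<length xs}. c i \<noteq> 0"
      and c0: "\<forall>e\<in>N. (\<Sum>i\<in>{..<length xs}. c i * (xs ! i) e) = 0"
      using nontrivial_kernel[OF fN, of "{..<length xs}" "\<lambda>i. xs ! i"] by auto
    have x: "xs ! i \<in> flow_polytope" if "i < length xs" for i using xs that by auto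
    define f where "f = (\<lambda>e. \<Sum>i<length xs. c i * (xs ! i) e)"
    have "circulation f"
      unfolding f_def using x by (intro circulation_sum) (auto simp: flow_polytope_def)
    then have f0: "f = (\<lambda>_. 0)"
      using circulation_on_tree_eq_0 c0 by (auto simp: f_def N_def)
    \<comment> \<open>Each point has mass 1, so the linear relation \<open>f = 0\<close> is
      automatically an affine one.\<close>
    have "0 = sum f E" by (simp add: f0)
    also have "\<dots> = (\<Sum>i<length xs. c i * sum (xs ! i) E)"
      unfolding f_def by (subst sum.swap) (simp add: sum_distrib_left)
    also have "\<dots> = (\<Sum>i<length xs. c i)"
      using x by (intro sum.cong) (auto simp: flow_polytope_def)
    finally have "(\<Sum>i<length xs. c i) = 0" by simp
    then show False using xs(2) f0 c unfolding aff_indep_def f_def by blast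
  qed
  obtain F where F: "\<And>e. e \<in> N \<Longrightarrow> circulation (F e)"
    "\<And>e e'. e \<in> N \<Longrightarrow> e' \<in> N \<Longrightarrow> F e e' = of_bool (e' = e)"
    using fundamental_circulation unfolding N_def by (metis DiffE)
  \<comment> \<open>\<open>K - 1\<close> dominates every ratio of \<open>F e\<close> to
    \<open>u\<close>, so \<open>K * u + F e\<close> is at least \<open>u\<close> on every
    edge.\<close>
  define K where "K = 1 + (\<Sum>e\<in>N. \<Sum>e'\<in>E. \<bar>F e e'\<bar> / u e')"
  have K_ge: "\<bar>F e e'\<bar> / u e' \<le> K - 1" if "e \<in> N" "e' \<in> E" for e e'
  proof -
    have "\<bar>F e e'\<bar> / u e' \<le> (\<Sum>e'\<in>E. \<bar>F e e'\<bar> / u e')"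
      using that finite_E u_pos by (intro member_le_sum) (auto intro!: divide_nonneg_pos)
    also have "\<dots> \<le> K - 1"
      unfolding K_def using that fN u_pos
      by (simp, intro member_le_sum) (auto intro!: sum_nonneg divide_nonneg_pos)
    finally show ?thesis .
  qed
  have K_pos: "K \<ge> 1" unfolding K_def using u_pos by (auto intro!: sum_nonneg divide_nonneg_pos)
  define y where "y e = (\<lambda>e'. K * u e' + 1 * F e e')" for e
  define s where "s e = sum (y e) E" for e
  \<comment> \<open>Normalization to mass 1; the zero summand only gives the form of
    \<open>circulation_add\<close>.\<close>
  define pt where "pt e = (\<lambda>e'. (1 / s e) * y e e' + 0 * y e e')" for e
  have y_pos: "y e e' > 0" if "e \<in> N" "e' \<in> E" for e e'
  proof -
    have "\<bar>F e e'\<bar> \<le> (K - 1) * u e'"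
      using K_ge[OF that] u_pos[OF that(2)] by (simp add: pos_divide_le_eq)
    then show ?thesis using u_pos[OF that(2)] by (simp add: y_def algebra_simps)
  qed
  have s_pos: "s e > 0" if "e \<in> N" for e
    unfolding s_def using that y_pos finite_E by (intro sum_pos) (auto simp: N_def)
  have pt_in: "pt e \<in> flow_polytope" if "e \<in> N" for e
  proof -
    have "circulation (y e)"
      unfolding y_def using F that u by (intro circulation_add) (auto simp: flow_polytope_def)
    then have "circulation (pt e)" unfolding pt_def by (intro circulation_add)
    moreover have "sum (pt e) E = 1"
      using s_pos[OF that] by (simp add: pt_def s_def sum_divide_distrib[symmetric])
    moreover have "\<forall>e'\<in>E. 0 \<le> pt e e'"
      using s_pos[OF that] y_pos[OF that] by (auto simp: pt_def intro: less_imp_le)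
    ultimately show ?thesis by (simp add: flow_polytope_def)
  qed
  obtain es where es: "set es = N" "distinct es" using finite_distinct_list[OF fN] by blast
  have "aff_indep (map pt es)"
    unfolding aff_indep_def
  proof (intro allI impI, elim conjE)
    fix c i assume eq: "(\<lambda>e. \<Sum>i<length (map pt es). c i * (map pt es ! i) e) = (\<lambda>_. 0)"
      and i: "i < length (map pt es)"
    define n where "n = length es"
    define d where "d j = c j / s (es ! j)" for j
    define D where "D = (\<Sum>j<n. d j)"
    have mem: "es ! j \<in> N" if "j < n" for j using that es by (auto simp: n_def)
    \<comment> \<open>On the \<open>l\<close>-th non-tree edge only the \<open>l\<close>-th
      fundamental circulation is nonzero.\<close>
    have d_eq: "d l = - (K * D * u (es ! l))" if l: "l < n" for l
    proof -
      have "0 = (\<Sum>j<n. c j * pt (es ! j) (es ! l))"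
        using fun_cong[OF eq, of "es ! l"] by (simp add: n_def)
      also have "\<dots> = (\<Sum>j<n. d j * (K * u (es ! l)) + d j * F (es ! j) (es ! l))"
        by (intro sum.cong) (auto simp: pt_def d_def y_def add_divide_distrib distrib_left)
      also have "\<dots> = (\<Sum>j<n. d j * (K * u (es ! l)) + (if j = l then d j else 0))"
        using l F(2) mem es(2) by (intro sum.cong) (auto simp: n_def nth_eq_iff_index_eq)
      also have "\<dots> = K * D * u (es ! l) + d l"
        using l by (simp add: sum.distrib D_def sum_distrib_right sum_distrib_left mult_ac)
      finally show ?thesis by simp
    qed
    define U where "U = (\<Sum>j<n. u (es ! j))"
    \<comment> \<open>Summing these equations over \<open>l\<close> gives an equation for
      \<open>D\<close> alone, with a positive factor \<open>1 + K * U\<close>.\<close>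
    have "D = (\<Sum>l<n. - (K * D * u (es ! l)))" unfolding D_def using d_eq D_def by simp
    then have "D = - (K * D * U)" by (simp add: U_def sum_negf sum_distrib_left)
    then have "D * (1 + K * U) = 0" by (simp add: algebra_simps)
    moreover have "0 \<le> U" unfolding U_def
      using mem u_pos by (intro sum_nonneg less_imp_le) (auto simp: N_def)
    then have "1 + K * U > 0" using K_pos by (intro add_pos_nonneg) auto
    ultimately have "D = 0" by simp
    then have "d i = 0" using d_eq i by (simp add: n_def)
    then show "c i = 0" using s_pos[OF mem[of i]] i by (simp add: d_def n_def)
  qed
  moreover have "length (map pt es) = card E - card V + 1"
    using es cardN distinct_card[OF es(2)] by simp
  moreover have "set (map pt es) \<subseteq> flow_polytope" using pt_in es by auto
  ultimately show ?thesis
    unfolding has_aff_dim_def using upper cardN by metis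
qed

end

end

section \<open>Standardization and permutations\<close>

lemma rank_less_iff:
  fixes S :: "'a::linorder set"
  assumes "finite S" "x \<in> S" "y \<in> S"
  shows "card {z\<in>S. z < x} < card {z\<in>S. z < y} \<longleftrightarrow> x < y"
proof -
  have "card {z\<in>S. z < a} < card {z\<in>S. z < b}" if "a < b" "a \<in> S" for a b
    using that assms(1) by (intro psubset_card_mono) auto
  from this[of x y] this[of y x] show ?thesis
    using assms(2,3) by (cases x y rule: linorder_cases) auto
qed

lemma std_map:
  assumes "\<And>x y. x \<in> set xs \<Longrightarrow> y \<in> set xs \<Longrightarrow> f x < f y \<longleftrightarrow> x < y"
  shows "std (map f xs) = std xs"
proof -
  have inj: "inj_on f (set xs)"
  proof (rule inj_onI)
    fix x y assume "x \<in> set xs" "y \<in> set xs" "f x = f y"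
    then show "x = y" using assms[of x y] assms[of y x] by (cases x y rule: linorder_cases) auto
  qed
  have "card {z\<in>set (map f xs). z < f x} = card {y\<in>set xs. y < x}" if "x \<in> set xs" for x
  proof -
    have "{z\<in>set (map f xs). z < f x} = f ` {y\<in>set xs. y < x}" using assms that by auto
    then show ?thesis using inj by (simp add: card_image inj_on_def)
  qed
  then show ?thesis unfolding std_def by simp
qed

lemma length_std [simp]: "length (std xs) = length xs"
  by (simp add: std_def)

lemma std_nth_less_iff:
  assumes "i < length xs" "j < length xs"
  shows "std xs ! i < std xs ! j \<longleftrightarrow> xs ! i < xs ! j"
  using assms by (simp add: std_def rank_less_iff)

lemma std_nth:
  assumes "distinct xs" "i < length xs"
  shows "std xs ! i = card {j. j < length xs \<and> xs ! j < xs ! i}"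
proof -
  have "{y\<in>set xs. y < xs ! i} = (!) xs ` {j. j < length xs \<and> xs ! j < xs ! i}"
    by (auto simp: in_set_conv_nth)
  moreover have "inj_on ((!) xs) {j. j < length xs \<and> xs ! j < xs ! i}"
    using assms(1) by (auto intro!: inj_onI simp: nth_eq_iff_index_eq)
  ultimately show ?thesis using assms(2) by (simp add: std_def card_image)
qed

lemma std_eqI:
  assumes "distinct xs" "distinct ys" "length xs = length ys"
    and "\<And>i j. i < length xs \<Longrightarrow> j < length xs \<Longrightarrow> xs ! i < xs ! j \<longleftrightarrow> ys ! i < ys ! j"
  shows "std xs = std ys"
proof (rule nth_equalityI)
  fix i assume i: "i < length (std xs)"
  then have "{j. j < length xs \<and> xs ! j < xs ! i} = {j. j < length ys \<and> ys ! j < ys ! i}"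
    using assms(3,4) by auto
  then show "std xs ! i = std ys ! i" using i assms by (simp add: std_nth)
qed (use assms in simp)

text \<open>Ranks within a larger list preserve order, so standardizing the whole list first does
  not change the pattern of a part. The next three lemmas are the cases of a window,
  \<open>butlast\<close> and \<open>tl\<close>.\<close>

lemma std_map_rank:
  assumes "set ys \<subseteq> set xs"
  shows "std (map (\<lambda>x. card {y\<in>set xs. y < x}) ys) = std ys"
  using assms by (intro std_map rank_less_iff) auto

lemma std_window_std: "std (take k (drop i (std xs))) = std (take k (drop i xs))"
proof -
  have "set (take k (drop i xs)) \<subseteq> set xs" by (meson in_set_dropD in_set_takeD subsetI)
  from std_map_rank[OF this] show ?thesis by (simp add: std_def[of xs] take_map drop_map)
qed

lemma std_butlast_std: "std (butlast (std xs)) = std (butlast xs)"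
proof -
  have "set (butlast xs) \<subseteq> set xs" by (meson in_set_butlastD subsetI)
  from std_map_rank[OF this] show ?thesis by (simp add: std_def[of xs] map_butlast)
qed

lemma std_tl_std: "std (tl (std xs)) = std (tl xs)"
proof -
  have "set (tl xs) \<subseteq> set xs" by (cases xs) auto
  from std_map_rank[OF this] show ?thesis by (simp add: std_def[of xs] map_tl)
qed

lemma perms_iff: "p \<in> perms n \<longleftrightarrow> distinct p \<and> (\<forall>x. x \<in> set p \<longleftrightarrow> x < n)"
  by (simp only: perms_def mem_Collect_eq set_eq_iff lessThan_iff)

lemma length_perms: "p \<in> perms n \<Longrightarrow> length p = n"
  unfolding perms_def using distinct_card[of p] by simp

lemma perms_eq: "perms n = permutations_of_set {..<n}"
  unfolding perms_def permutations_of_set_def by blast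

lemma finite_perms: "finite (perms n)"
  by (simp add: perms_eq)

lemma card_perms: "card (perms n) = fact n"
  by (simp add: perms_eq)

text \<open>Ranks of distinct entries are distinct and below the length, so by counting they take
  every value.\<close>

lemma std_in_perms:
  assumes "distinct xs"
  shows "std xs \<in> perms (length xs)"
proof -
  have inj: "inj_on (\<lambda>x. card {y\<in>set xs. y < x}) (set xs)"
  proof (rule inj_onI)
    fix x y assume "x \<in> set xs" "y \<in> set xs" "card {z\<in>set xs. z < x} = card {z\<in>set xs. z < y}"
    then show "x = y"
      using rank_less_iff[of "set xs" x y] rank_less_iff[of "set xs" y x]
      by (cases x y rule: linorder_cases) auto
  qed
  have "card {y\<in>set xs. y < x} < length xs" if "x \<in> set xs" for x
  proof -
    have "card {y\<in>set xs. y < x} < card (set xs)" using that by (intro psubset_card_mono) auto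
    then show ?thesis using assms by (simp add: distinct_card)
  qed
  then have "set (std xs) \<subseteq> {..<length xs}" by (auto simp: std_def)
  moreover have dist: "distinct (std xs)" using assms inj by (simp add: std_def distinct_map)
  then have "card (set (std xs)) = length xs" by (simp add: distinct_card)
  ultimately have "set (std xs) = {..<length xs}" by (intro card_subset_eq) auto
  with dist show ?thesis by (simp add: perms_def)
qed

lemma std_perms:
  assumes "p \<in> perms n"
  shows "std p = p"
proof -
  have set_p: "set p = {..<n}" using assms by (simp add: perms_def)
  have "card {y \<in> set p. y < x} = x" if "x \<in> set p" for x
  proof -
    have "{y \<in> set p. y < x} = {..<x}" using that unfolding set_p by auto
    then show ?thesis by simp
  qed
  then show ?thesis unfolding std_def by (rule map_idI)
qed

section \<open>Vertices and edges of the overlap graph\<close>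

lemma be_in_perms: "p \<in> perms (Suc n) \<Longrightarrow> be p \<in> perms n"
  using std_in_perms[of "butlast p"] length_perms[of p "Suc n"]
  by (simp add: be_def perms_def distinct_butlast)

lemma en_in_perms: "p \<in> perms (Suc n) \<Longrightarrow> en p \<in> perms n"
  using std_in_perms[of "tl p"] length_perms[of p "Suc n"]
  by (simp add: en_def perms_def distinct_tl)

lemma std_snoc_greatest:
  assumes "distinct w" "\<And>y. y \<in> set w \<Longrightarrow> y < x"
  shows "std (w @ [x]) = std w @ [length w]"
proof -
  have "{z \<in> set (w @ [x]). z < x} = set w" using assms by auto
  moreover have "{z \<in> set (w @ [x]). z < y} = {z \<in> set w. z < y}" if "y \<in> set w" for y
    using assms(2)[OF that] by auto
  ultimately show ?thesis using assms(1) unfolding std_def by (simp add: distinct_card)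
qed

lemma snoc_in_perms: "p \<in> perms n \<Longrightarrow> p @ [n] \<in> perms (Suc n)"
  unfolding perms_iff by force

lemma be_snoc: "p \<in> perms n \<Longrightarrow> be (p @ [n]) = p"
  by (simp add: be_def std_perms)

text \<open>Hence the edges \<open>p @ [n]\<close> contain a spanning tree of the overlap graph that is directed
  towards the increasing permutation.\<close>

lemma snoc_max_reaches_increasing:
  assumes p: "p \<in> perms n"
  shows "((\<lambda>p. en (p @ [n])) ^^ n) p = std [n..<n + n]"
proof -
  \<comment> \<open>Each step appends a new maximum and drops the first entry; after
    \<open>n\<close> steps nothing of \<open>p\<close> is left.\<close>
  have "((\<lambda>p. en (p @ [n])) ^^ j) p = std (drop j (p @ [n..<n + j]))" for j
  proof (induction j)
    case 0 then show ?case using p by (simp add: std_perms)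
  next
    case (Suc j)
    define w where "w = drop j (p @ [n..<n + j])"
    have len: "length w = n" using length_perms[OF p] by (simp add: w_def)
    have "distinct (p @ [n..<n + j])" using p unfolding perms_iff by force
    then have "distinct w" unfolding w_def by (rule distinct_drop)
    moreover have "y < n + j" if "y \<in> set w" for y
    proof -
      have "y \<in> set (p @ [n..<n + j])" using that unfolding w_def by (rule in_set_dropD)
      then show ?thesis using p unfolding perms_iff by force
    qed
    ultimately have snoc: "std (w @ [n + j]) = std w @ [n]" using len by (simp add: std_snoc_greatest)
    have step: "en (std w @ [n]) = std (tl (w @ [n + j]))"
      unfolding en_def snoc[symmetric] by (rule std_tl_std)
    have "w @ [n + j] = drop j (p @ [n..<n + Suc j])"
      using length_perms[OF p] by (simp add: w_def)
    then have "tl (w @ [n + j]) = drop (Suc j) (p @ [n..<n + Suc j])"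
      by (simp only: drop_Suc tl_drop)
    moreover have "((\<lambda>p. en (p @ [n])) ^^ Suc j) p = en (std w @ [n])"
      using Suc by (simp add: w_def)
    ultimately show ?case using step by simp
  qed
  from this[of n] show ?thesis using length_perms[OF p] by simp
qed

lemma be_rotate1:
  assumes "p \<noteq> []"
  shows "be (rotate1 p) = en p"
  using assms by (cases p) (simp_all add: be_def en_def)

text \<open>Moving the first entry to the end turns the end of a permutation into its beginning, so
  every vertex has equal in-degree and out-degree.\<close>

lemma bij_betw_rotate1_perms:
  "bij_betw rotate1 {p \<in> perms (Suc n). en p = q} {p \<in> perms (Suc n). be p = q}"
proof (rule bij_betw_imageI)
  show "inj_on rotate1 {p \<in> perms (Suc n). en p = q}"
    by (meson inj_rotate1 inj_on_subset subset_UNIV)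
  have ne: "p \<noteq> []" if "p \<in> perms (Suc n)" for p using length_perms[OF that] by auto
  show "rotate1 ` {p \<in> perms (Suc n). en p = q} = {p \<in> perms (Suc n). be p = q}"
  proof safe
    fix p assume "p \<in> perms (Suc n)"
    then show "rotate1 p \<in> perms (Suc n)" "be (rotate1 p) = en p"
      using ne by (auto simp: perms_iff be_rotate1)
  next
    fix p assume p: "p \<in> perms (Suc n)" "q = be p"
    obtain p' where p': "p = rotate1 p'" using surj_rotate1 by blast
    then have "p' \<in> perms (Suc n)" using p by (simp add: perms_iff)
    then show "p \<in> rotate1 ` {p' \<in> perms (Suc n). en p' = be p}"
      using p' ne[of p'] by (intro image_eqI[of _ _ p']) (simp_all add: be_rotate1)
  qed
qed

section \<open>Realizing walks of the overlap graph\<close>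

text \<open>The order prescribed by \<open>p\<close> confines the new value to a nonempty open
  interval, which is infinite and so has a point outside \<open>F\<close>. Later \<open>F\<close>
  consists of all earlier values, also those outside the window \<open>ws\<close>.\<close>

lemma extend_pattern:
  fixes ws :: "real list"
  assumes p: "p \<in> perms (Suc n)" and ws: "distinct ws" "std ws = be p" and F: "finite F"
  shows "\<exists>x. x \<notin> F \<and> std (ws @ [x]) = p"
proof -
  define q where "q = butlast p"
  define a where "a = last p"
  have lp: "length p = Suc n" using p by (rule length_perms)
  have p_eq: "p = q @ [a]" using lp by (cases p rule: rev_cases) (auto simp: q_def a_def)
  have lq: "length q = n" using lp by (simp add: q_def)
  have lw: "length ws = n" using arg_cong[OF ws(2), of length] lq by (simp add: be_def q_def)
  have dp: "distinct q" "a \<notin> set q" using p unfolding p_eq perms_iff by force+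
  have iso: "ws ! i < ws ! j \<longleftrightarrow> q ! i < q ! j" if "i < n" "j < n" for i j
    using std_nth_less_iff[of i ws j] std_nth_less_iff[of i q j] that ws(2) lw lq
    by (simp add: be_def q_def)
  \<comment> \<open>\<open>L\<close> and \<open>U\<close> are the values that must lie below and
    above the new one.\<close>
  define L where "L = (!) ws ` {i. i < n \<and> q ! i < a}"
  define U where "U = (!) ws ` {i. i < n \<and> a < q ! i}"
  have fin: "finite L" "finite U" by (auto simp: L_def U_def)
  have LU: "l < u" if "l \<in> L" "u \<in> U" for l u
    using that iso unfolding L_def U_def by fastforce
  \<comment> \<open>\<open>Max L\<close> serves unless \<open>L\<close> is empty. Inserting 0 here,
    and \<open>lo + 1\<close> in \<open>hi\<close>, keeps the minimum defined when \<open>U\<close>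
    is empty.\<close>
  obtain lo where lo: "\<And>l. l \<in> L \<Longrightarrow> l \<le> lo" "\<And>u. u \<in> U \<Longrightarrow> lo < u"
  proof (cases "L = {}")
    case True
    show ?thesis
    proof (rule that[of "Min (insert 0 U) - 1"])
      fix u assume "u \<in> U"
      then have "Min (insert 0 U) \<le> u" using fin by simp
      then show "Min (insert 0 U) - 1 < u" by simp
    qed (use True in simp)
  next
    case False
    then show ?thesis using fin LU by (intro that[of "Max L"]) auto
  qed
  define hi where "hi = Min (insert (lo + 1) U)"
  have "lo < hi" using lo(2) fin by (simp add: hi_def)
  then have "infinite ({lo<..<hi} - (F \<union> set ws))" using F by (simp add: infinite_Ioo)
  then obtain x where "x \<in> {lo<..<hi} - (F \<union> set ws)"
    by (metis finite.emptyI subsetI subset_antisym ex_in_conv)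
  then have x: "lo < x" "x < hi" "x \<notin> F" "x \<notin> set ws" by auto
  have lt: "ws ! i < x \<longleftrightarrow> q ! i < a" "x < ws ! i \<longleftrightarrow> a < q ! i" if i: "i < n" for i
  proof -
    have "ws ! i < x" if "q ! i < a" using lo(1)[of "ws ! i"] x that i by (force simp: L_def)
    moreover have "x < ws ! i" if "a < q ! i"
    proof -
      have "hi \<le> ws ! i" unfolding hi_def using fin that i by (intro Min_le) (auto simp: U_def)
      then show ?thesis using x by simp
    qed
    moreover have "q ! i \<noteq> a" using dp lq i by (metis nth_mem)
    ultimately show "ws ! i < x \<longleftrightarrow> q ! i < a" "x < ws ! i \<longleftrightarrow> a < q ! i" by force+
  qed
  have "std (ws @ [x]) = std p"
  proof (rule std_eqI)
    fix i j assume "i < length (ws @ [x])" "j < length (ws @ [x])"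
    then show "(ws @ [x]) ! i < (ws @ [x]) ! j \<longleftrightarrow> p ! i < p ! j"
      using lw lq lt iso by (auto simp: p_eq nth_append less_Suc_eq)
  qed (use ws x p lp lw in \<open>auto simp: perms_iff\<close>)
  then show ?thesis using x(3) std_perms[OF p] by auto
qed

text \<open>A walk of \<open>N\<close> edges becomes \<open>N + n\<close> values. The invariant on
  the last \<open>n\<close> values says that the walk stands at the start of the next edge
  \<open>f N\<close>, which is what \<open>extend_pattern\<close> requires.\<close>

lemma realize_walk:
  fixes f :: "nat \<Rightarrow> nat list"
  assumes f: "\<And>i. f i \<in> perms (Suc n)" "\<And>i. en (f i) = be (f (Suc i))"
  shows "\<exists>xs::real list. distinct xs \<and> length xs = N + n \<and>
    (\<forall>i<N. std (take (Suc n) (drop i xs)) = f i) \<and> std (drop N xs) = be (f N)"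
proof (induction N)
  case 0
  have b: "be (f 0) \<in> perms n" using f be_in_perms by blast
  have "std (map real (be (f 0))) = be (f 0)"
    using std_map[of "be (f 0)" real] std_perms[OF b] by simp
  moreover have "distinct (map real (be (f 0)))" using b by (simp add: perms_iff distinct_map)
  ultimately show ?case
    using length_perms[OF b] by (intro exI[of _ "map real (be (f 0))"]) simp
next
  case (Suc N)
  then obtain xs :: "real list" where xs: "distinct xs" "length xs = N + n"
    "\<forall>i<N. std (take (Suc n) (drop i xs)) = f i" "std (drop N xs) = be (f N)" by blast
  obtain x where x: "x \<notin> set xs" "std (drop N xs @ [x]) = f N"
    using extend_pattern[OF f(1) _ xs(4), of "set xs"] xs(1) by auto
  have "std (take (Suc n) (drop i (xs @ [x]))) = f i" if "i < Suc N" for i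
  proof (cases "i = N")
    case True then show ?thesis using x xs(2) by simp
  next
    case False then show ?thesis using xs that by simp
  qed
  moreover have "std (drop (Suc N) (xs @ [x])) = be (f (Suc N))"
  proof -
    \<comment> \<open>Dropping the first entry of the newest window leaves the arrival vertex of
      \<open>f N\<close>.\<close>
    have "drop (Suc N) (xs @ [x]) = tl (drop N xs @ [x])"
      using xs(2) by (simp add: drop_Suc tl_drop[symmetric] del: drop_append) simp
    then show ?thesis
      using std_tl_std[of "drop N xs @ [x]"] x(2) f(2)[of N] by (simp add: en_def)
  qed
  ultimately show ?case using xs x by (intro exI[of _ "xs @ [x]"]) simp
qed

section \<open>Counting consecutive patterns\<close>

text \<open>\<open>cocc\<close> over an arbitrary linear order, so that sequences of reals can be
  counted before standardization.\<close>

definition wcount :: "nat list \<Rightarrow> 'a::linorder list \<Rightarrow> nat" where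
  "wcount p xs = card {i. i + length p \<le> length xs \<and> std (take (length p) (drop i xs)) = p}"

lemma cocc_std: "cocc p (std xs) = wcount p xs"
  by (simp add: cocc_def wcount_def std_window_std)

lemma wcount_map_add:
  fixes xs :: "real list"
  shows "wcount p (map (\<lambda>x. x + c) xs) = wcount p xs"
  by (simp add: wcount_def drop_map take_map std_map)

text \<open>A window lies in \<open>xs\<close>, lies in \<open>ys\<close>, or straddles the
  junction; a straddling one starts among the last \<open>length p\<close> positions of
  \<open>xs\<close>.\<close>

lemma wcount_append:
  assumes "p \<noteq> []"
  shows "wcount p xs + wcount p ys \<le> wcount p (xs @ ys)"
    and "wcount p (xs @ ys) \<le> wcount p xs + wcount p ys + length p"
proof -
  define k where "k = length p"
  have k: "k > 0" using assms by (simp add: k_def)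
  define A where "A = {i. i + k \<le> length xs \<and> std (take k (drop i xs)) = p}"
  define B where "B = {i. i + k \<le> length ys \<and> std (take k (drop i ys)) = p}"
  define C where "C = {i. i + k \<le> length (xs @ ys) \<and> std (take k (drop i (xs @ ys))) = p}"
  define B' where "B' = (\<lambda>i. i + length xs) ` B"
  have cards: "wcount p xs = card A" "wcount p ys = card B" "wcount p (xs @ ys) = card C"
    by (simp_all add: wcount_def A_def B_def C_def k_def)
  have fin: "finite A" "finite B" "finite C"
    by (rule finite_subset[of _ "{..length (xs @ ys)}"]; force simp: A_def B_def C_def)+
  have cardB: "card B' = card B" unfolding B'_def by (intro card_image) simp
  have "card A + card B' = card (A \<union> B')"
    using fin k by (intro card_Un_disjoint[symmetric]) (auto simp: B'_def A_def)
  also have "A \<union> B' \<subseteq> C" unfolding A_def B'_def B_def C_def by auto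
  then have "card (A \<union> B') \<le> card C" using fin by (intro card_mono)
  finally show "wcount p xs + wcount p ys \<le> wcount p (xs @ ys)" by (simp add: cards cardB)
  have "C \<subseteq> A \<union> B' \<union> {length xs - k..<length xs}"
  proof
    fix i assume i: "i \<in> C"
    show "i \<in> A \<union> B' \<union> {length xs - k..<length xs}"
    proof (cases "length xs \<le> i")
      case True
      then have "i - length xs \<in> B" using i by (auto simp: C_def B_def)
      then have "i \<in> B'" unfolding B'_def using True by (intro image_eqI[of _ _ "i - length xs"]) simp_all
      then show ?thesis by simp
    next
      case False
      show ?thesis
      proof (cases "i + k \<le> length xs")
        case True
        then have "i \<in> A" using i by (simp add: C_def A_def)
        then show ?thesis by simp
      next
        case False
        then have "i \<in> {length xs - k..<length xs}" using \<open>\<not> length xs \<le> i\<close> by simp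
        then show ?thesis by blast
      qed
    qed
  qed
  then have "card C \<le> card (A \<union> B' \<union> {length xs - k..<length xs})"
    using fin by (intro card_mono) (simp_all add: B'_def)
  also have "\<dots> \<le> card A + card B' + card {length xs - k..<length xs}"
    using card_Un_le[of "A \<union> B'" "{length xs - k..<length xs}"] card_Un_le[of A B'] by linarith
  finally show "wcount p (xs @ ys) \<le> wcount p xs + wcount p ys + length p"
    by (simp add: cards cardB k_def)
qed

lemma card_periodic:
  assumes "C \<noteq> []"
  shows "card {i. i < r * length C \<and> C ! (i mod length C) = p} = r * count_list C p"
proof (induction r)
  case (Suc r)
  define L where "L = length C"
  have L: "L > 0" using assms by (simp add: L_def)
  define B where "B = {i. i < L \<and> C ! i = p}"
  define A where "A = {i. i < r * L \<and> C ! (i mod L) = p}"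
  have "{i. i < Suc r * L \<and> C ! (i mod L) = p} = A \<union> (\<lambda>i. i + r * L) ` B"
  proof (intro set_eqI iffI)
    fix i assume i: "i \<in> {i. i < Suc r * L \<and> C ! (i mod L) = p}"
    show "i \<in> A \<union> (\<lambda>i. i + r * L) ` B"
    proof (cases "i < r * L")
      case True then show ?thesis using i by (simp add: A_def)
    next
      case False
      then obtain j where j: "i = j + r * L" by (metis add.commute le_Suc_ex not_less)
      then have "j \<in> B" using i by (auto simp: B_def)
      then show ?thesis using j by blast
    qed
  next
    fix i assume "i \<in> A \<union> (\<lambda>i. i + r * L) ` B"
    then show "i \<in> {i. i < Suc r * L \<and> C ! (i mod L) = p}"
      by (auto simp: A_def B_def)
  qed
  moreover have "card (A \<union> (\<lambda>i. i + r * L) ` B) = card A + card ((\<lambda>i. i + r * L) ` B)"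
    by (intro card_Un_disjoint) (auto simp: A_def B_def)
  moreover have "card ((\<lambda>i. i + r * L) ` B) = card B" by (intro card_image) simp
  moreover have "card B = count_list C p"
    by (simp add: B_def L_def count_list_eq_length_filter length_filter_conv_card eq_commute)
  ultimately show ?case using Suc by (simp add: A_def L_def)
qed simp

text \<open>Going round \<open>C\<close> exactly \<open>r\<close> times is a walk of
  \<open>r * length C\<close> edges, and its realization has one window of length
  \<open>Suc n\<close> per edge.\<close>

lemma realize_cycle:
  assumes C: "is_cycle (perms (Suc n)) be en C" "C \<noteq> []"
  shows "\<exists>xs::real list. distinct xs \<and> length xs = r * length C + n \<and>
    (\<forall>p\<in>perms (Suc n). wcount p xs = r * count_list C p)"
proof -
  define L where "L = length C"
  have L: "L > 0" using C(2) by (simp add: L_def)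
  define f where "f i = C ! (i mod L)" for i
  have C': "set C \<subseteq> perms (Suc n)" "map en C = rotate1 (map be C)"
    using C by (simp_all add: cycle_iff_rotate1)
  have "f i \<in> perms (Suc n)" for i
    using C'(1) L nth_mem[of "i mod L" C] by (auto simp: f_def L_def)
  moreover have "en (f i) = be (f (Suc i))" for i
  proof -
    have "map en C ! (i mod L) = be (C ! (Suc (i mod L) mod L))"
      unfolding C'(2) using L by (simp add: nth_rotate1 L_def)
    then show ?thesis using L by (simp add: f_def L_def mod_Suc_eq)
  qed
  ultimately obtain xs :: "real list" where xs: "distinct xs" "length xs = r * L + n"
    "\<forall>i<r * L. std (take (Suc n) (drop i xs)) = f i"
    using realize_walk[of f n "r * L"] by blast
  have "wcount p xs = r * count_list C p" if p: "p \<in> perms (Suc n)" for p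
  proof -
    have "{i. i + length p \<le> length xs \<and> std (take (length p) (drop i xs)) = p}
        = {i. i < r * L \<and> C ! (i mod L) = p}"
      using xs length_perms[OF p] by (auto simp: f_def)
    then show ?thesis by (simp add: wcount_def card_periodic[OF C(2)] L_def)
  qed
  then show ?thesis using xs by (intro exI[of _ xs]) (simp add: L_def)
qed

text \<open>Concatenation, after shifting the values to make them distinct, plays the role of a
  direct sum of permutations: each junction creates at most \<open>k\<close> additional windows. No walks
  between the cycles are needed.\<close>

lemma realize_cycles:
  fixes C :: "nat \<Rightarrow> nat list list" and r :: "nat \<Rightarrow> nat"
  assumes "\<And>i. i < N \<Longrightarrow> is_cycle (perms (Suc n)) be en (C i) \<and> C i \<noteq> []"
  shows "\<exists>xs::real list. distinct xs \<and> length xs = (\<Sum>i<N. r i * length (C i) + n) \<and>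
    (\<forall>p\<in>perms (Suc n). (\<Sum>i<N. r i * count_list (C i) p) \<le> wcount p xs \<and>
       wcount p xs \<le> (\<Sum>i<N. r i * count_list (C i) p) + N * Suc n)"
  using assms
proof (induction N)
  case 0
  have "wcount p ([] :: real list) = 0" if "p \<in> perms (Suc n)" for p
    using length_perms[OF that] by (simp add: wcount_def)
  then show ?case by (intro exI[of _ "[]"]) simp
next
  case (Suc N)
  then obtain xs :: "real list" where xs: "distinct xs"
    "length xs = (\<Sum>i<N. r i * length (C i) + n)"
    "\<forall>p\<in>perms (Suc n). (\<Sum>i<N. r i * count_list (C i) p) \<le> wcount p xs \<and>
       wcount p xs \<le> (\<Sum>i<N. r i * count_list (C i) p) + N * Suc n"
    by fastforce
  obtain ys :: "real list" where ys: "distinct ys" "length ys = r N * length (C N) + n"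
    "\<forall>p\<in>perms (Suc n). wcount p ys = r N * count_list (C N) p"
    using realize_cycle[of n "C N" "r N"] Suc.prems[of N] by auto
  \<comment> \<open>\<open>c\<close> exceeds \<open>\<bar>x\<bar> + \<bar>y\<bar>\<close> for all
    entries, so the shifted \<open>ys\<close> lie above all of \<open>xs\<close>.\<close>
  define c where "c = (\<Sum>x\<in>set xs. \<bar>x\<bar>) + (\<Sum>y\<in>set ys. \<bar>y\<bar>) + 1"
  have less: "x < y + c" if "x \<in> set xs" "y \<in> set ys" for x y
  proof -
    have "\<bar>x\<bar> \<le> (\<Sum>x\<in>set xs. \<bar>x\<bar>)" "\<bar>y\<bar> \<le> (\<Sum>y\<in>set ys. \<bar>y\<bar>)"
      using that by (auto intro!: member_le_sum)
    then show ?thesis by (simp add: c_def)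
  qed
  define zs where "zs = xs @ map (\<lambda>y. y + c) ys"
  have "distinct zs"
    using xs(1) ys(1) less by (force simp: zs_def distinct_map inj_on_def)
  moreover have "length zs = (\<Sum>i<Suc N. r i * length (C i) + n)"
    by (simp add: zs_def xs ys)
  moreover have "(\<Sum>i<Suc N. r i * count_list (C i) p) \<le> wcount p zs \<and>
       wcount p zs \<le> (\<Sum>i<Suc N. r i * count_list (C i) p) + Suc N * Suc n"
    if p: "p \<in> perms (Suc n)" for p
  proof -
    have lp: "length p = Suc n" using p by (rule length_perms)
    then have "p \<noteq> []" by auto
    from wcount_append[OF this, of xs "map (\<lambda>y. y + c) ys"] show ?thesis
      using bspec[OF xs(3) p] bspec[OF ys(3) p] by (simp add: wcount_map_add zs_def lp)
  qed
  ultimately show ?case by blast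
qed

section \<open>The feasible region\<close>

text \<open>Each window has a single pattern, so the positions of different patterns are
  disjoint.\<close>

lemma sum_cocc:
  assumes "A \<subseteq> perms k" "finite A"
  shows "(\<Sum>p\<in>A. cocc p s) = card {i. i + k \<le> length s \<and> std (take k (drop i s)) \<in> A}"
proof -
  define W where "W p = {i. i + k \<le> length s \<and> std (take k (drop i s)) = p}" for p
  have "cocc p s = card (W p)" if "p \<in> A" for p
    using length_perms[of p k] assms(1) that by (auto simp: cocc_def W_def)
  then have "(\<Sum>p\<in>A. cocc p s) = (\<Sum>p\<in>A. card (W p))" by simp
  also have "\<dots> = card (\<Union>p\<in>A. W p)"
  proof (rule card_UN_disjoint[symmetric])
    have "W p \<subseteq> {..length s}" for p by (auto simp: W_def)
    then show "\<forall>p\<in>A. finite (W p)" by (meson finite_atMost finite_subset)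
    show "\<forall>p\<in>A. \<forall>q\<in>A. p \<noteq> q \<longrightarrow> W p \<inter> W q = {}" by (auto simp: W_def)
  qed (use assms in simp)
  also have "(\<Union>p\<in>A. W p) = {i. i + k \<le> length s \<and> std (take k (drop i s)) \<in> A}"
    by (auto simp: W_def)
  finally show ?thesis .
qed

lemma window_in_perms:
  assumes "distinct s" "i + k \<le> length s"
  shows "std (take k (drop i s)) \<in> perms k"
  using std_in_perms[of "take k (drop i s)"] assms by (simp add: distinct_take distinct_drop)

lemma sum_cocc_perms:
  assumes "distinct s"
  shows "(\<Sum>p\<in>perms k. cocc p s) = length s + 1 - k"
proof -
  have "{i. i + k \<le> length s \<and> std (take k (drop i s)) \<in> perms k} = {..<length s + 1 - k}"
    using window_in_perms[OF assms] by auto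
  then show ?thesis by (simp add: sum_cocc[OF subset_refl finite_perms])
qed

text \<open>Both sums count occurrences of \<open>q\<close>; the first one misses at most the last window, the
  second one at most the first window.\<close>

lemma sum_cocc_be_en:
  assumes "distinct s"
  shows "\<bar>(\<Sum>p\<in>{p\<in>perms (Suc n). be p = q}. real (cocc p s))
    - (\<Sum>p\<in>{p\<in>perms (Suc n). en p = q}. real (cocc p s))\<bar> \<le> 1"
proof -
  define W where "W i = std (take (Suc n) (drop i s))" for i
  define B where "B = {i. i + n \<le> length s \<and> std (take n (drop i s)) = q}"
  define X where "X = {i. i + Suc n \<le> length s \<and> W i \<in> {p\<in>perms (Suc n). be p = q}}"
  define Y where "Y = {i. i + Suc n \<le> length s \<and> W i \<in> {p\<in>perms (Suc n). en p = q}}"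
  have "B \<subseteq> {..length s}" by (auto simp: B_def)
  then have fB: "finite B" by (rule finite_subset) simp
  have W: "W i \<in> perms (Suc n)" "be (W i) = std (take n (drop i s))"
    "en (W i) = std (take n (drop (Suc i) s))" if "i + Suc n \<le> length s" for i
  proof -
    show "W i \<in> perms (Suc n)" unfolding W_def using assms that by (rule window_in_perms)
    have "butlast (take (Suc n) (drop i s)) = take n (drop i s)"
      using that by (simp add: butlast_take)
    then show "be (W i) = std (take n (drop i s))" by (simp add: W_def be_def std_butlast_std)
    have "tl (take (Suc n) (drop i s)) = take n (drop (Suc i) s)"
      by (simp add: drop_Suc tl_drop tl_take)
    then show "en (W i) = std (take n (drop (Suc i) s))" by (simp add: W_def en_def std_tl_std)
  qed
  have X: "X = B - {length s - n}"
  proof (intro set_eqI iffI)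
    fix i assume "i \<in> X" then show "i \<in> B - {length s - n}"
      using W(2)[of i] by (auto simp: X_def B_def)
  next
    fix i assume i: "i \<in> B - {length s - n}"
    then have "i + Suc n \<le> length s" by (auto simp: B_def)
    then show "i \<in> X" using W(1,2)[of i] i by (auto simp: X_def B_def)
  qed
  \<comment> \<open>The end of the window at \<open>j\<close> starts at \<open>j + 1\<close>, hence
    the shift by \<open>Suc\<close>.\<close>
  have Y: "Suc ` Y = B - {0}"
  proof (intro set_eqI iffI)
    fix i assume "i \<in> Suc ` Y"
    then obtain j where "i = Suc j" "j \<in> Y" by blast
    then show "i \<in> B - {0}" using W(3)[of j] by (auto simp: Y_def B_def)
  next
    fix i assume i: "i \<in> B - {0}"
    then obtain j where j: "i = Suc j" by (metis DiffE insertI1 not0_implies_Suc)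
    then have "j + Suc n \<le> length s" using i by (auto simp: B_def)
    then have "j \<in> Y" using W(1,3)[of j] i j by (auto simp: Y_def B_def)
    then show "i \<in> Suc ` Y" using j by blast
  qed
  have bound: "card (B - {x}) \<le> card B \<and> card B \<le> card (B - {x}) + 1" for x
    using fB card_Diff_singleton_if[of B x] by (auto simp: card_gt_0_iff)
  have "card (Suc ` Y) = card Y" by (intro card_image) simp
  then have "card X \<le> card B \<and> card B \<le> card X + 1" "card Y \<le> card B \<and> card B \<le> card Y + 1"
    using bound X Y by metis+
  moreover have "(\<Sum>p\<in>{p\<in>perms (Suc n). be p = q}. cocc p s) = card X"
    unfolding X_def W_def using finite_perms by (intro sum_cocc) auto
  moreover have "(\<Sum>p\<in>{p\<in>perms (Suc n). en p = q}. cocc p s) = card Y"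
    unfolding Y_def W_def using finite_perms by (intro sum_cocc) auto
  ultimately show ?thesis by (simp only: of_nat_sum[symmetric]) linarith
qed

section \<open>The feasible region as the flow polytope of the overlap graph\<close>

lemma overlap_graph: "finite_digraph (perms n) (perms (Suc n)) be en"
  by unfold_locales (simp_all add: finite_perms be_in_perms en_in_perms)

text \<open>For length \<open>l\<close> the densities add up to \<open>(l - n) / l\<close> once
  \<open>l\<close> exceeds \<open>n\<close>, and the imbalance at a vertex is at most
  \<open>1 / l\<close>. Both errors vanish in the limit.\<close>

lemma feasible_subset_flow_polytope:
  "feasible_region (Suc n) \<subseteq> finite_digraph.flow_polytope (perms n) (perms (Suc n)) be en"
proof
  interpret finite_digraph "perms n" "perms (Suc n)" be en by (rule overlap_graph)
  fix v assume "v \<in> feasible_region (Suc n)"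
  then obtain \<s> where supp: "supp_in (Suc n) v" and v: "\<forall>p\<in>perms (Suc n). 0 \<le> v p \<and> v p \<le> 1"
    and s: "\<And>m. \<s> m \<in> perms (length (\<s> m))"
    and len: "filterlim (\<lambda>m. length (\<s> m)) at_top sequentially"
    and lim: "\<And>p. p \<in> perms (Suc n) \<Longrightarrow> (\<lambda>m. cocc_prop p (\<s> m)) \<longlonglongrightarrow> v p"
    unfolding feasible_region_def by blast
  define l where "l m = real (length (\<s> m))" for m
  have l: "filterlim l at_top sequentially"
    unfolding l_def using len by (simp add: filterlim_compose[OF filterlim_real_sequentially])
  have l_inf: "filterlim l at_infinity sequentially"
    using l by (rule filterlim_at_top_imp_at_infinity)
  have dist: "distinct (\<s> m)" for m using s by (simp add: perms_iff)
  have prop_eq: "cocc_prop p (\<s> m) = real (cocc p (\<s> m)) / l m" for p m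
    by (simp add: cocc_prop_def l_def)
  have "(\<lambda>m. \<Sum>p\<in>perms (Suc n). cocc_prop p (\<s> m)) \<longlonglongrightarrow> sum v (perms (Suc n))"
    using lim by (intro tendsto_sum)
  moreover have "(\<lambda>m. \<Sum>p\<in>perms (Suc n). cocc_prop p (\<s> m)) \<longlonglongrightarrow> 1 - 0"
  proof (rule Lim_transform_eventually)
    show "(\<lambda>m. 1 - real n / l m) \<longlonglongrightarrow> 1 - 0"
      by (intro tendsto_diff tendsto_const tendsto_divide_0[OF tendsto_const l_inf])
    show "\<forall>\<^sub>F m in sequentially. 1 - real n / l m = (\<Sum>p\<in>perms (Suc n). cocc_prop p (\<s> m))"
    proof -
      have "\<forall>\<^sub>F m in sequentially. Suc n \<le> length (\<s> m)"
        using len by (simp add: filterlim_at_top)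
      then show ?thesis
      proof eventually_elim
        case (elim m)
        have "(\<Sum>p\<in>perms (Suc n). cocc_prop p (\<s> m)) = real (length (\<s> m) + 1 - Suc n) / l m"
          unfolding prop_eq sum_divide_distrib[symmetric] sum_cocc_perms[OF dist, symmetric] by simp
        moreover have "real (length (\<s> m) + 1 - Suc n) = l m - real n" "l m \<noteq> 0"
          using elim by (auto simp: l_def of_nat_diff)
        ultimately show ?case by (simp add: diff_divide_distrib)
      qed
    qed
  qed
  ultimately have "sum v (perms (Suc n)) = 1"
    using LIMSEQ_unique by fastforce
  moreover have "excess v q = 0" for q
  proof -
    define D where "D m = (\<Sum>p\<in>{p\<in>perms (Suc n). be p = q}. cocc_prop p (\<s> m))
      - (\<Sum>p\<in>{p\<in>perms (Suc n). en p = q}. cocc_prop p (\<s> m))" for m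
    have "D \<longlonglongrightarrow> excess v q"
      unfolding D_def excess_def using lim by (intro tendsto_diff tendsto_sum) auto
    moreover have "D \<longlonglongrightarrow> 0"
    proof (rule tendsto_0_le[where K = 1])
      show "(\<lambda>m. 1 / l m) \<longlonglongrightarrow> 0" by (rule tendsto_divide_0[OF tendsto_const l_inf])
      have "norm (D m) \<le> norm (1 / l m) * 1" for m
      proof -
        have "D m = ((\<Sum>p\<in>{p\<in>perms (Suc n). be p = q}. real (cocc p (\<s> m)))
          - (\<Sum>p\<in>{p\<in>perms (Suc n). en p = q}. real (cocc p (\<s> m)))) / l m"
          unfolding D_def prop_eq by (simp add: sum_divide_distrib diff_divide_distrib)
        moreover have "0 \<le> l m" by (simp add: l_def)
        ultimately show ?thesis
          using sum_cocc_be_en[OF dist[of m], where n = n and q = q] by (simp add: abs_divide divide_right_mono)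
      qed
      then show "\<forall>\<^sub>F m in sequentially. norm (D m) \<le> norm (1 / l m) * 1" by simp
    qed
    ultimately show ?thesis using LIMSEQ_unique by blast
  qed
  ultimately show "v \<in> flow_polytope"
    using supp v by (auto simp: flow_polytope_def circulation_def supp_in_def)
qed

lemma floor_multiple_tendsto:
  fixes a :: real
  assumes "a \<ge> 0"
  shows "(\<lambda>m. real (nat \<lfloor>real m * a\<rfloor>) / real m) \<longlonglongrightarrow> a"
proof (rule tendsto_sandwich)
  have eq: "real (nat \<lfloor>real m * a\<rfloor>) = real_of_int \<lfloor>real m * a\<rfloor>" for m using assms by simp
  show "\<forall>\<^sub>F m in sequentially. a - 1 / real m \<le> real (nat \<lfloor>real m * a\<rfloor>) / real m"
    using eventually_gt_at_top[of 0]
  proof eventually_elim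
    case (elim m)
    have "real m * a - 1 \<le> real_of_int \<lfloor>real m * a\<rfloor>" by linarith
    then have "(real m * a - 1) / real m \<le> real_of_int \<lfloor>real m * a\<rfloor> / real m"
      by (rule divide_right_mono) simp
    then show ?case using elim unfolding eq by (simp add: diff_divide_distrib)
  qed
  show "\<forall>\<^sub>F m in sequentially. real (nat \<lfloor>real m * a\<rfloor>) / real m \<le> a"
    using eventually_gt_at_top[of 0]
  proof eventually_elim
    case (elim m)
    have "real_of_int \<lfloor>real m * a\<rfloor> \<le> real m * a" by linarith
    then show ?case using elim unfolding eq by (simp add: field_simps)
  qed
  have "(\<lambda>m. a - 1 / real m) \<longlonglongrightarrow> a - 0" by (intro tendsto_diff tendsto_const lim_1_over_n)
  then show "(\<lambda>m. a - 1 / real m) \<longlonglongrightarrow> a" by simp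
qed simp

text \<open>Cycle \<open>C i\<close> is repeated about \<open>m * c i / L i\<close> times and so
  contributes about \<open>m * c i\<close> windows. The total length is about \<open>m\<close> and
  the count of \<open>p\<close> about \<open>m * v p\<close>, with errors from the junctions that
  are bounded in \<open>m\<close>.\<close>

lemma cycle_polytope_subset_feasible:
  "cycle_polytope (perms (Suc n)) be en \<subseteq> feasible_region (Suc n)"
proof
  interpret finite_digraph "perms n" "perms (Suc n)" be en by (rule overlap_graph)
  fix v assume v: "v \<in> cycle_polytope (perms (Suc n)) be en"
  then have vQ: "v \<in> flow_polytope" by (simp add: flow_polytope_eq_cycle_polytope)
  obtain N :: nat and c :: "nat \<Rightarrow> real" and x where
    cx: "\<forall>i<N. 0 \<le> c i \<and> x i \<in> {cycle_vec C | C. simple_cycle (perms (Suc n)) be en C}"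
    and c1: "(\<Sum>i<N. c i) = 1" and v_eq: "v = (\<lambda>e. \<Sum>i<N. c i * x i e)"
    using v unfolding cycle_polytope_def conv_def by blast
  then have "\<exists>C. \<forall>i<N. x i = cycle_vec (C i) \<and> simple_cycle (perms (Suc n)) be en (C i)"
    by (intro choice) blast
  then obtain C where x: "\<And>i. i < N \<Longrightarrow> x i = cycle_vec (C i)"
    and C: "\<And>i. i < N \<Longrightarrow> simple_cycle (perms (Suc n)) be en (C i)" by blast
  have cyc: "is_cycle (perms (Suc n)) be en (C i) \<and> C i \<noteq> []" if "i < N" for i
    using C[OF that] by (simp add: simple_cycle_def)
  define L where "L i = real (length (C i))" for i
  have L: "L i > 0" if "i < N" for i using cyc[OF that] by (simp add: L_def)
  define r where "r m i = nat \<lfloor>real m * (c i / L i)\<rfloor>" for m i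
  have r_lim: "(\<lambda>m. real (r m i) / real m) \<longlonglongrightarrow> c i / L i" if "i < N" for i
    unfolding r_def using cx that L[OF that] by (intro floor_multiple_tendsto) simp
  have "\<exists>xs. \<forall>m. distinct (xs m :: real list) \<and> length (xs m) = (\<Sum>i<N. r m i * length (C i) + n) \<and>
    (\<forall>p\<in>perms (Suc n). (\<Sum>i<N. r m i * count_list (C i) p) \<le> wcount p (xs m) \<and>
       wcount p (xs m) \<le> (\<Sum>i<N. r m i * count_list (C i) p) + N * Suc n)"
    by (intro choice allI realize_cycles cyc)
  then obtain xs :: "nat \<Rightarrow> real list" where xs: "\<And>m. distinct (xs m)"
    "\<And>m. length (xs m) = (\<Sum>i<N. r m i * length (C i) + n)"
    "\<And>m p. p \<in> perms (Suc n) \<Longrightarrow> (\<Sum>i<N. r m i * count_list (C i) p) \<le> wcount p (xs m)"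
    "\<And>m p. p \<in> perms (Suc n) \<Longrightarrow>
        wcount p (xs m) \<le> (\<Sum>i<N. r m i * count_list (C i) p) + N * Suc n"
    by blast
  define \<s> where "\<s> m = std (xs m)" for m
  define l where "l m = real (length (xs m))" for m
  have scaled: "(\<lambda>m. (\<Sum>i<N. real (r m i) * w i) / real m) \<longlonglongrightarrow> (\<Sum>i<N. c i / L i * w i)" for w
  proof -
    have "(\<lambda>m. \<Sum>i<N. real (r m i) / real m * w i) \<longlonglongrightarrow> (\<Sum>i<N. c i / L i * w i)"
      using r_lim by (intro tendsto_sum tendsto_mult tendsto_const) auto
    then show ?thesis by (simp add: sum_divide_distrib)
  qed
  have const_lim: "(\<lambda>m. a / real m) \<longlonglongrightarrow> 0" for a :: real
    by (rule lim_const_over_n)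
  have l_lim: "(\<lambda>m. l m / real m) \<longlonglongrightarrow> 1"
  proof -
    \<comment> \<open>Each of the \<open>N\<close> realized walks has \<open>n\<close> values more
      than edges, a constant surplus \<open>N * n\<close>.\<close>
    have "l m / real m = (\<Sum>i<N. real (r m i) * L i) / real m + real (N * n) / real m" for m
      by (simp add: l_def xs(2) L_def sum.distrib add_divide_distrib)
    moreover have "(\<Sum>i<N. c i / L i * L i) = (\<Sum>i<N. c i)"
      using L by (intro sum.cong) force+
    ultimately show ?thesis
      using tendsto_add[OF scaled[of L] const_lim[of "real (N * n)"]] c1 by simp
  qed
  have w_lim: "(\<lambda>m. real (wcount p (xs m)) / real m) \<longlonglongrightarrow> v p" if p: "p \<in> perms (Suc n)" for p
  proof -
    define S where "S m = (\<Sum>i<N. real (r m i) * real (count_list (C i) p))" for m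
    have "(\<Sum>i<N. c i / L i * real (count_list (C i) p)) = v p"
      unfolding v_eq by (intro sum.cong) (auto simp: x cycle_vec_def L_def)
    then have S: "(\<lambda>m. S m / real m) \<longlonglongrightarrow> v p"
      unfolding S_def using scaled[of "\<lambda>i. real (count_list (C i) p)"] by simp
    have le: "S m \<le> real (wcount p (xs m))" for m
      using xs(3)[OF p, of m] unfolding S_def by (simp only: of_nat_mult[symmetric] of_nat_sum[symmetric] of_nat_le_iff)
    have ge: "real (wcount p (xs m)) \<le> S m + real (N * Suc n)" for m
      using xs(4)[OF p, of m] unfolding S_def
      by (simp only: of_nat_mult[symmetric] of_nat_sum[symmetric] of_nat_add[symmetric] of_nat_le_iff)
    show ?thesis
    proof (rule tendsto_sandwich)
      show "(\<lambda>m. S m / real m) \<longlonglongrightarrow> v p" by (rule S)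
      show "(\<lambda>m. S m / real m + real (N * Suc n) / real m) \<longlonglongrightarrow> v p"
        using tendsto_add[OF S const_lim[of "real (N * Suc n)"]] by simp
      show "\<forall>\<^sub>F m in sequentially. S m / real m \<le> real (wcount p (xs m)) / real m"
        using le by (simp add: divide_right_mono)
      show "\<forall>\<^sub>F m in sequentially. real (wcount p (xs m)) / real m \<le> S m / real m + real (N * Suc n) / real m"
        using ge by (simp only: add_divide_distrib[symmetric]) (simp add: divide_right_mono)
    qed
  qed
  have "filterlim l at_top sequentially"
  proof -
    have "filterlim (\<lambda>m. l m / real m * real m) at_top sequentially"
      by (rule filterlim_tendsto_pos_mult_at_top[OF l_lim _ filterlim_real_sequentially]) simp
    moreover have "\<forall>\<^sub>F m in sequentially. l m / real m * real m = l m"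
      using eventually_gt_at_top[of 0] by eventually_elim simp
    ultimately show ?thesis by (simp add: filterlim_cong[OF refl refl])
  qed
  then have "filterlim (\<lambda>m. length (\<s> m)) at_top sequentially"
    unfolding l_def \<s>_def by (simp add: filterlim_sequentially_iff_filterlim_real)
  moreover have "\<s> m \<in> perms (length (\<s> m))" for m
    using std_in_perms[OF xs(1), of m] by (simp add: \<s>_def)
  moreover have "(\<lambda>m. cocc_prop p (\<s> m)) \<longlonglongrightarrow> v p" if p: "p \<in> perms (Suc n)" for p
  proof -
    \<comment> \<open>Count and length are both compared with \<open>m\<close>, which cancels for
      positive \<open>m\<close>.\<close>
    have "(\<lambda>m. (real (wcount p (xs m)) / real m) / (l m / real m)) \<longlonglongrightarrow> v p / 1"
      using w_lim[OF p] l_lim by (intro tendsto_divide) simp_all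
    moreover have "\<forall>\<^sub>F m in sequentially.
        (real (wcount p (xs m)) / real m) / (l m / real m) = cocc_prop p (\<s> m)"
      using eventually_gt_at_top[of 0]
      by eventually_elim (simp add: cocc_prop_def \<s>_def cocc_std l_def)
    ultimately show ?thesis by (simp add: Lim_transform_eventually)
  qed
  moreover have "v p \<le> 1" if "p \<in> perms (Suc n)" for p
    using vQ that finite_perms member_le_sum[of p "perms (Suc n)" v] by (auto simp: flow_polytope_def)
  ultimately show "v \<in> feasible_region (Suc n)"
    using vQ unfolding feasible_region_def flow_polytope_def circulation_def supp_in_def by blast
qed

text \<open>The rotation bijection gives equal in-degree and out-degree. This is the everywhere
  positive point for the dimension count.\<close>

lemma uniform_in_flow_polytope:
  "(\<lambda>p. of_bool (p \<in> perms (Suc n)) / fact (Suc n)) \<in>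
     finite_digraph.flow_polytope (perms n) (perms (Suc n)) be en"
proof -
  interpret finite_digraph "perms n" "perms (Suc n)" be en by (rule overlap_graph)
  have "card {p \<in> perms (Suc n). be p = q} = card {p \<in> perms (Suc n). en p = q}" for q
    using bij_betw_same_card[OF bij_betw_rotate1_perms] by metis
  then show ?thesis
    by (simp add: flow_polytope_def circulation_def excess_def card_perms del: fact_Suc)
qed

theorem mainTheorem13:
  fixes k :: nat
  assumes "k \<ge> 2"
  shows "feasible_region k = cycle_polytope (perms k) be en
       \<and> vertices (feasible_region k) = {cycle_vec C | C. simple_cycle (perms k) be en C}
       \<and> has_aff_dim (feasible_region k) (fact k - fact (k - 1))
       \<and> feasible_region k =
           {v. supp_in k v \<and> (\<forall>p\<in>perms k. 0 \<le> v p \<and> v p \<le> 1) \<and>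
               (\<Sum>p\<in>perms k. v p) = 1 \<and>
               (\<forall>rho\<in>perms (k - 1).
                  (\<Sum>p\<in>{p\<in>perms k. be p = rho}. v p) = (\<Sum>p\<in>{p\<in>perms k. en p = rho}. v p))}"
proof -
  obtain n where k: "k = Suc n" using assms by (cases k) auto
  interpret finite_digraph "perms n" "perms (Suc n)" be en by (rule overlap_graph)
  have feasible: "feasible_region (Suc n) = flow_polytope"
    using feasible_subset_flow_polytope[of n] cycle_polytope_subset_feasible[of n]
    unfolding flow_polytope_eq_cycle_polytope by (rule subset_antisym)
  \<comment> \<open>The root of the spanning tree is the increasing permutation, and the tree edge
    at \<open>p\<close> is \<open>p @ [n]\<close>.\<close>
  have "std [n..<n + n] \<in> perms n" using std_in_perms[of "[n..<n + n]"] by simp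
  then have "has_aff_dim flow_polytope (card (perms (Suc n)) - card (perms n))"
    by (rule has_aff_dim_flow_polytope[where t = "\<lambda>p. p @ [n]" and m = n, OF _ _ _ _ uniform_in_flow_polytope])
      (simp_all add: snoc_in_perms be_snoc snoc_max_reaches_increasing)
  then have dim: "has_aff_dim flow_polytope (fact (Suc n) - fact n)" by (simp only: card_perms)
  \<comment> \<open>A single nonnegative coordinate cannot exceed the total mass 1; this supplies
    the bound of the unit cube.\<close>
  have "v p \<le> 1" if "v \<in> flow_polytope" "p \<in> perms (Suc n)" for v p
    using that finite_perms member_le_sum[of p "perms (Suc n)" v] by (auto simp: flow_polytope_def)
  then have "flow_polytope = {v. supp_in (Suc n) v \<and> (\<forall>p\<in>perms (Suc n). 0 \<le> v p \<and> v p \<le> 1) \<and>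
      (\<Sum>p\<in>perms (Suc n). v p) = 1 \<and>
      (\<forall>rho\<in>perms n. (\<Sum>p\<in>{p\<in>perms (Suc n). be p = rho}. v p)
                    = (\<Sum>p\<in>{p\<in>perms (Suc n). en p = rho}. v p))}"
    by (auto simp: flow_polytope_def circulation_def excess_def supp_in_def)
  then show ?thesis
    using dim unfolding k feasible diff_Suc_1
    by (intro conjI flow_polytope_eq_cycle_polytope vertices_flow_polytope)
qed

end
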